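(* Let $\sigma$ be a layered permutation with layers of sizes $(\ell_1,\dots,\ell_k)$, $k\ge 2$. If $\ell_1\ge 2$, $\ell_k\ge 2$ and $\ell_i+\ell_{i+1}\ge\max\{\ell_1,\ell_k\}+1$ for every $i\in[k-1]$, then every $\sigma$-optimal layered permuton has finitely many layers.
   Context: A layered permutation $\sigma$ of order $m$ with layers of sizes $(\ell_1,\ldots,\ell_k)$: $[m]$ is partitioned into consecutive intervals $I_1,\ldots,I_k$ (in order), $|I_j|=\ell_j$, $\sigma$ decreasing on each $I_j$, and $\sigma(x)<\sigma(x')$ for $x\in I_j,x'\in I_{j'}$, $j<j'$. A permuton is a Borel probability measure $\Pi$ on $[0,1]^2$ with uniform marginals: $\Pi([a,b]\times[0,1])=\Pi([0,1]\times[a,b])=b-a$ for $0\le a\le b\le 1$. A $\Pi$-random permutation of order $m$ is obtained by sampling $m$ points independently from $\Pi$, sorting them by $x$-coordinate as $(x_1,y_1),\ldots,(x_m,y_m)$, and letting $\tau(i)<\tau(j)$ iff $y_i<y_j$. The density $d(\sigma,\Pi)$ is the probability that a $\Pi$-random permutation of order $|\sigma|$ equals $\sigma$. A permuton $\Pi$ is $\sigma$-optimal if $d(\sigma,\Pi)$ equals the packing density of $\sigma$ (the limit as $n\to\infty$ of the maximum density of $\sigma$ in permutations of order $n$, where the density of $\sigma$ in a permutation $\pi$ is the probability that $|\sigma|$ random distinct positions of $\pi$ induce the pattern $\sigma$); equivalently $d(\sigma,\Pi)$ is the maximum of $d(\sigma,\cdot)$ over all permutons. A permuton $\Pi$ is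 layered if there is a collection $\mathcal{J}$ of internally disjoint closed subintervals of $[0,1]$ (possibly of length zero) such that the support of $\Pi$ consists exactly of the points $(x,y)$ with $x\in[a,b]\in\mathcal{J}$ and $y=b-(x-a)$; the elements of $\mathcal{J}$ (uniquely determined) are the layers of $\Pi$, and the number of layers is $|\mathcal{J}|$. *)

theory Defs
  imports "HOL-Probability.Probability" "HOL-Combinatorics.Permutations"
begin

text \<open>
  A permutation of order \<open>m\<close> is a function \<open>\<sigma> :: nat \<Rightarrow> nat\<close> with \<open>\<sigma> permutes {1..m}\<close>;
  layer sizes are given as \<open>l 1, \<dots>, l k\<close>.
\<close>

definition layer_interval :: "(nat \<Rightarrow> nat) \<Rightarrow> nat \<Rightarrow> nat set" where
  "layer_interval l j = {(\<Sum>i=1..<j. l i) <.. (\<Sum>i=1..j. l i)}"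

definition layered_perm :: "nat \<Rightarrow> (nat \<Rightarrow> nat) \<Rightarrow> (nat \<Rightarrow> nat) \<Rightarrow> bool" where
  "layered_perm k l \<sigma> \<longleftrightarrow>
     \<sigma> permutes {1..(\<Sum>i=1..k. l i)} \<and>
     (\<forall>j\<in>{1..k}. l j \<ge> 1) \<and>
     (\<forall>j\<in>{1..k}. \<forall>x\<in>layer_interval l j. \<forall>x'\<in>layer_interval l j.
        x < x' \<longrightarrow> \<sigma> x > \<sigma> x') \<and>
     (\<forall>j\<in>{1..k}. \<forall>j'\<in>{1..k}. j < j' \<longrightarrow>
        (\<forall>x\<in>layer_interval l j. \<forall>x'\<in>layer_interval l j'. \<sigma> x < \<sigma> x'))"


definition occurrences :: "nat \<Rightarrow> (nat \<Rightarrow> nat) \<Rightarrow> nat \<Rightarrow> (nat \<Rightarrow> nat) \<Rightarrow> nat set set" where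
  "occurrences m \<sigma> n \<pi> =
     {S. S \<subseteq> {1..n} \<and> card S = m \<and>
         (\<exists>s. strict_mono_on {1..m} s \<and> s ` {1..m} = S \<and>
              (\<forall>i\<in>{1..m}. \<forall>j\<in>{1..m}. \<sigma> i < \<sigma> j \<longleftrightarrow> \<pi> (s i) < \<pi> (s j)))}"

definition pattern_density :: "nat \<Rightarrow> (nat \<Rightarrow> nat) \<Rightarrow> nat \<Rightarrow> (nat \<Rightarrow> nat) \<Rightarrow> real" where
  "pattern_density m \<sigma> n \<pi> = real (card (occurrences m \<sigma> n \<pi>)) / real (n choose m)"

text \<open>
  The limit below exists: by averaging over the deletion of one position, the maximum density is
  non-increasing in \<open>n\<close> once \<open>n \<ge> m\<close>. For \<open>n < m\<close> the density is \<open>0 / 0 = 0\<close>.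
\<close>

definition packing_density :: "nat \<Rightarrow> (nat \<Rightarrow> nat) \<Rightarrow> real" where
  "packing_density m \<sigma> = lim (\<lambda>n. Max (pattern_density m \<sigma> n ` {\<pi>. \<pi> permutes {1..n}}))"


definition permuton :: "(real \<times> real) measure \<Rightarrow> bool" where
  "permuton P \<longleftrightarrow>
     prob_space P \<and>
     sets P = sets (restrict_space borel ({0..1} \<times> {0..1})) \<and>
     (\<forall>a b. 0 \<le> a \<and> a \<le> b \<and> b \<le> 1 \<longrightarrow>
        measure P ({a..b} \<times> {0..1}) = b - a \<and> measure P ({0..1} \<times> {a..b}) = b - a)"

text \<open>
  The sampled points \<open>p 1, \<dots>, p m\<close> induce \<open>\<sigma>\<close> if the reindexing \<open>\<rho>\<close> sorting them by first coordinate
  makes their second coordinates order-isomorphic to \<open>\<sigma>\<close>. Samples with two equal first or two equal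
  second coordinates induce nothing; for a permuton they form a null set.
\<close>

definition induces_perm :: "nat \<Rightarrow> (nat \<Rightarrow> nat) \<Rightarrow> (nat \<Rightarrow> real \<times> real) \<Rightarrow> bool" where
  "induces_perm m \<sigma> p \<longleftrightarrow>
     (\<exists>\<rho>. \<rho> permutes {1..m} \<and>
        (\<forall>i\<in>{1..m}. \<forall>j\<in>{1..m}. i < j \<longrightarrow> fst (p (\<rho> i)) < fst (p (\<rho> j))) \<and>
        (\<forall>i\<in>{1..m}. \<forall>j\<in>{1..m}. \<sigma> i < \<sigma> j \<longleftrightarrow> snd (p (\<rho> i)) < snd (p (\<rho> j))))"

definition permuton_density :: "nat \<Rightarrow> (nat \<Rightarrow> nat) \<Rightarrow> (real \<times> real) measure \<Rightarrow> real" where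
  "permuton_density m \<sigma> P =
     (let M = Pi\<^sub>M {1..m} (\<lambda>_. P) in measure M {p \<in> space M. induces_perm m \<sigma> p})"

definition optimal_permuton :: "nat \<Rightarrow> (nat \<Rightarrow> nat) \<Rightarrow> (real \<times> real) measure \<Rightarrow> bool" where
  "optimal_permuton m \<sigma> P \<longleftrightarrow> permuton P \<and> permuton_density m \<sigma> P = packing_density m \<sigma>"


definition msupport :: "'a::topological_space measure \<Rightarrow> 'a set" where
  "msupport M = {z \<in> space M. \<forall>U. open U \<longrightarrow> z \<in> U \<longrightarrow> emeasure M (U \<inter> space M) > 0}"

text \<open>
  Internal disjointness is read as: an interior point of one interval lies in no other interval.
  For intervals of positive length this says that the interiors are disjoint; it moreover forbids
  placing a degenerate interval inside another one. Disjointness of interiors alone would allow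
  adding \<open>{(a + b) / 2}\<close> to a collection containing \<open>{a..b}\<close> without changing the union of the
  antidiagonals, and the layers would not be unique.
\<close>

definition layer_collection :: "(real \<times> real) measure \<Rightarrow> real set set \<Rightarrow> bool" where
  "layer_collection P J \<longleftrightarrow>
     (\<forall>I\<in>J. \<exists>a b. 0 \<le> a \<and> a \<le> b \<and> b \<le> 1 \<and> I = {a..b}) \<and>
     (\<forall>I\<in>J. \<forall>I'\<in>J. I \<noteq> I' \<longrightarrow> interior I \<inter> I' = {}) \<and>
     msupport P = {(x, y). \<exists>a b. {a..b} \<in> J \<and> x \<in> {a..b} \<and> y = b - (x - a)}"

definition layered_permuton :: "(real \<times> real) measure \<Rightarrow> bool" where
  "layered_permuton P \<longleftrightarrow> permuton P \<and> (\<exists>J. layer_collection P J)"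

definition layers :: "(real \<times> real) measure \<Rightarrow> real set set" where
  "layers P = (THE J. layer_collection P J)"

lemma layer_collection_mono:
  assumes J: "layer_collection P J" and K: "layer_collection P K" and I: "I \<in> J"
  shows "I \<in> K"
proof -
  have supp: "msupport P = {(x, y). \<exists>a b. {a..b} \<in> J' \<and> x \<in> {a..b} \<and> y = b - (x - a)}"
    if "layer_collection P J'" for J'
    using that unfolding layer_collection_def by (elim conjE)
  have dom: "\<exists>c d. {c..d} \<in> K' \<and> c + d = a + b \<and> c \<le> a \<and> b \<le> d"
    if J': "layer_collection P J'" and K': "layer_collection P K'"
      and I': "{a..b} \<in> J'" and ab: "a \<le> b"
    for J' K' and a b :: real
  proof -
    have "\<exists>a' b'. {a'..b'} \<in> J' \<and> a \<in> {a'..b'} \<and> b = b' - (a - a')"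
      by (rule exI[of _ a], rule exI[of _ b]) (simp add: I' ab)
    then have "(a, b) \<in> msupport P"
      unfolding supp[OF J'] by (simp only: mem_Collect_eq case_prod_conv)
    then have "\<exists>c d. {c..d} \<in> K' \<and> a \<in> {c..d} \<and> b = d - (a - c)"
      unfolding supp[OF K'] by (simp only: mem_Collect_eq case_prod_conv)
    then obtain c d where cd: "{c..d} \<in> K'" "a \<in> {c..d}" "b = d - (a - c)"
      by (elim exE conjE)
    show ?thesis
      by (rule exI[of _ c], rule exI[of _ d]) (use cd in \<open>simp\<close>)
  qed
  have "\<exists>a b. 0 \<le> a \<and> a \<le> b \<and> b \<le> 1 \<and> I = {a..b}"
    using J I unfolding layer_collection_def by (elim conjE) (erule bspec)
  then obtain a b where ab: "a \<le> b" "I = {a..b}"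
    by (elim exE conjE)
  obtain c d where cd: "{c..d} \<in> K" "c + d = a + b" "c \<le> a" "b \<le> d"
    using dom[OF J K I[unfolded ab(2)] ab(1)] by (elim exE conjE)
  have "c \<le> d" using cd ab by linarith
  obtain a' b' where ab': "{a'..b'} \<in> J" "a' + b' = c + d" "a' \<le> c" "d \<le> b'"
    using dom[OF K J cd(1) \<open>c \<le> d\<close>] by (elim exE conjE)
  have disj: "\<forall>I\<in>J. \<forall>I'\<in>J. I \<noteq> I' \<longrightarrow> interior I \<inter> I' = {}"
    using J unfolding layer_collection_def by (elim conjE)
  have "a' = a"
  proof (rule ccontr)
    assume "a' \<noteq> a"
    then have lt: "a' < a" "b < b'" using ab cd ab' by linarith+
    then have "(a + b) / 2 \<in> interior {a'..b'} \<inter> I"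
      using ab by simp
    moreover have "{a'..b'} \<noteq> I"
      using lt ab by (simp add: Icc_eq_Icc)
    ultimately show False
      using disj[rule_format, OF ab'(1) I] by (metis empty_iff)
  qed
  then have "c = a" "d = b" using cd ab' by linarith+
  with cd ab show ?thesis by simp
qed

lemma layers_eq: "layers P = J" if "layer_collection P J"
  unfolding layers_def
proof (rule the_equality[where P = "layer_collection P", OF that])
  fix K assume "layer_collection P K"
  then show "K = J"
    using layer_collection_mono that by (intro equalityI subsetI)
qed

end

theory Submission imports Defs begin

text \<open>
  A layered permuton is encoded by the monotone function \<open>g\<close> that maps each point of a layer of
  positive length to the left end of the layer and fixes all other points. For a pattern with block
  function \<open>b\<close>, its density is a constant times the probability that \<open>m\<close> independent uniform points
  satisfy \<open>g (x i) < g (x j) \<longleftrightarrow> b i < b j\<close>, an event denoted \<open>E g\<close>. Every monotone function is a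
  competitor, so an optimal \<open>g\<close> maximises the probability of \<open>E\<close>.

  Suppose that there are infinitely many layers of positive length. Then a monotone sequence of
  them exists; merge everything between two consecutive members into one layer, of length \<open>s\<close>, say.
  Let \<open>\<delta>\<close> be the probability that two points fall into different layers of the merged stretch. The
  loss is at most a constant times \<open>\<delta> s^(l i + l (i + 1) - 2)\<close>, while letting the first or the last
  block, of size \<open>l j\<close>, use the merged layer and the other blocks use fixed layers of the sequence
  gains a constant times \<open>\<delta> s^(l j - 2)\<close>. By the assumption on the sizes the gain wins once \<open>s\<close> is small.

  If only finitely many layers have positive length but there are infinitely many layers, then some
  open interval consists of layers of length zero. As no two adjacent blocks have size one, such an
  interval serves at most one block at a time, and cutting it into two layers is an improvement.
\<close>

section \<open>Maximal pattern densities\<close>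

text \<open>No permuton is constructed for a competitor \<open>h\<close>. Instead, \<open>n\<close>
  independent points are sorted and ordered by their levels under \<open>h\<close>, downwards within
  a level. In the resulting permutation the expected density of the pattern is at least
  \<open>fact m\<close> times the probability of \<open>Q h\<close>, the sorted part of
  \<open>E h\<close>. So \<open>h\<close> bounds the packing density from below, while the density
  of the given permuton is bounded from above through \<open>g\<close>; these two inequalities make
  \<open>g\<close> a maximiser.

  The coordinates of a sorted sample cannot be changed independently of each other. The larger event
  \<open>E\<close> has no order condition, and the ratio of the two probabilities depends on the
  pattern only; in \<open>E\<close> single coordinates may be prescribed or resampled.

  A stretch between two layers may contain arbitrarily many levels in an arbitrary arrangement. This
  is why loss and gain are compared with the same probability \<delta>, whose size is never
  estimated and which cancels. What remains is a lower bound on the measure of the stretch that does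
  not depend on the stretch, which is impossible for infinitely many disjoint stretches.\<close>

lemma ex_perm_of_order:
  fixes R :: "nat \<Rightarrow> nat \<Rightarrow> bool"
  assumes irrefl: "\<And>i. i \<in> {1..n} \<Longrightarrow> \<not> R i i"
    and trans: "\<And>i j k. i \<in> {1..n} \<Longrightarrow> j \<in> {1..n} \<Longrightarrow> k \<in> {1..n} \<Longrightarrow> R i j \<Longrightarrow> R j k \<Longrightarrow> R i k"
    and total: "\<And>i j. i \<in> {1..n} \<Longrightarrow> j \<in> {1..n} \<Longrightarrow> i \<noteq> j \<Longrightarrow> R i j \<or> R j i"
  obtains \<pi> where "\<pi> permutes {1..n}"
    "\<And>i j. i \<in> {1..n} \<Longrightarrow> j \<in> {1..n} \<Longrightarrow> \<pi> i < \<pi> j \<longleftrightarrow> R i j"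
proof -
  define r where "r i = card {j \<in> {1..n}. R j i}" for i
  have less: "r i < r j" if "i \<in> {1..n}" "j \<in> {1..n}" "R i j" for i j
  proof -
    have "{a \<in> {1..n}. R a i} \<subseteq> {a \<in> {1..n}. R a j}" using that trans by blast
    moreover have "i \<in> {a \<in> {1..n}. R a j}" "i \<notin> {a \<in> {1..n}. R a i}" using that irrefl by blast+
    ultimately show ?thesis unfolding r_def by (intro psubset_card_mono) (simp, blast)
  qed
  have iff: "r i < r j \<longleftrightarrow> R i j" if "i \<in> {1..n}" "j \<in> {1..n}" for i j
    using less[of i j] less[of j i] total[of i j] that by (metis less_asym less_irrefl)
  define \<pi> where "\<pi> i = (if i \<in> {1..n} then Suc (r i) else i)" for i
  have "inj_on \<pi> {1..n}"
  proof (rule inj_onI)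
    fix i j assume "i \<in> {1..n}" "j \<in> {1..n}" "\<pi> i = \<pi> j"
    then show "i = j"
      using less[of i j] less[of j i] total[of i j] unfolding \<pi>_def by (metis Suc_inject less_irrefl)
  qed
  moreover have "\<pi> ` {1..n} \<subseteq> {1..n}"
  proof (intro image_subsetI)
    fix i assume i: "i \<in> {1..n}"
    then have "{a \<in> {1..n}. R a i} \<subset> {1..n}" using irrefl by blast
    then have "r i < card {1..n}" unfolding r_def by (intro psubset_card_mono) simp_all
    then show "\<pi> i \<in> {1..n}" using i by (auto simp: \<pi>_def)
  qed
  ultimately have "bij_betw \<pi> {1..n} {1..n}"
    by (simp add: bij_betw_def endo_inj_surj)
  then have "\<pi> permutes {1..n}"
    by (rule bij_imp_permutes) (unfold \<pi>_def, simp only: if_False)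
  then show thesis
    by (rule that) (use iff in \<open>simp add: \<pi>_def\<close>)
qed

lemma occurrences_finite [simp]: "finite (occurrences m \<sigma> n \<pi>)"
  by (rule finite_subset[of _ "Pow {1..n}"]) (auto simp: occurrences_def)

text \<open>The coface map: the increasing injection whose range omits exactly
  \<open>v\<close>.\<close>

definition skip :: "nat \<Rightarrow> nat \<Rightarrow> nat" where
  "skip v i = (if i < v then i else Suc i)"

lemma skip_less_iff: "skip v i < skip v j \<longleftrightarrow> i < j"
  by (auto simp: skip_def)

lemma skip_image:
  assumes "v \<in> {1..Suc n}" shows "skip v ` {1..n} = {1..Suc n} - {v}"
proof -
  have "x \<in> skip v ` {1..n}" if "x \<in> {1..Suc n}" "x \<noteq> v" for x
    using that assms by (intro image_eqI[of _ _ "if x < v then x else x - 1"]) (auto simp: skip_def)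
  then show ?thesis using assms by (fastforce simp: skip_def)
qed

text \<open>Every occurrence that avoids \<open>v\<close> is the image under \<open>skip v\<close>
  of an occurrence in \<open>\<pi>'\<close>, so taking images covers the set on the left.\<close>

lemma occurrences_delete:
  assumes v: "v \<in> {1..Suc n}"
    and \<pi>': "\<And>i j. i \<in> {1..n} \<Longrightarrow> j \<in> {1..n} \<Longrightarrow> \<pi>' i < \<pi>' j \<longleftrightarrow> \<pi> (skip v i) < \<pi> (skip v j)"
  shows "card {S \<in> occurrences m \<sigma> (Suc n) \<pi>. v \<notin> S} \<le> card (occurrences m \<sigma> n \<pi>')"
proof (rule surj_card_le)
  show "{S \<in> occurrences m \<sigma> (Suc n) \<pi>. v \<notin> S} \<subseteq> (\<lambda>S. skip v ` S) ` occurrences m \<sigma> n \<pi>'"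
  proof (intro subsetI)
    fix S assume "S \<in> {S \<in> occurrences m \<sigma> (Suc n) \<pi>. v \<notin> S}"
    then have S: "S \<subseteq> {1..Suc n} - {v}" "card S = m"
      and "\<exists>s. strict_mono_on {1..m} s \<and> s ` {1..m} = S \<and>
        (\<forall>i\<in>{1..m}. \<forall>j\<in>{1..m}. \<sigma> i < \<sigma> j \<longleftrightarrow> \<pi> (s i) < \<pi> (s j))"
      unfolding occurrences_def by blast+
    then obtain s where s: "strict_mono_on {1..m} s" "s ` {1..m} = S"
      "\<And>i j. i \<in> {1..m} \<Longrightarrow> j \<in> {1..m} \<Longrightarrow> \<sigma> i < \<sigma> j \<longleftrightarrow> \<pi> (s i) < \<pi> (s j)"
      by (elim exE conjE) metis
    have skip_eq: "skip v a = skip v a' \<longleftrightarrow> a = a'" for a a'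
      by (metis linorder_neq_iff skip_less_iff)
    then have inj: "inj_on (skip v) A" for A by (simp add: inj_on_def)
    define s' where "s' i = (THE a. a \<in> {1..n} \<and> skip v a = s i)" for i
    have s': "s' i \<in> {1..n} \<and> skip v (s' i) = s i" if "i \<in> {1..m}" for i
    proof -
      have "s i \<in> S" using s(2) that by blast
      then have "s i \<in> skip v ` {1..n}" using S(1) skip_image[OF v] by blast
      then obtain a where "a \<in> {1..n}" "s i = skip v a" by blast
      then have "\<exists>!a. a \<in> {1..n} \<and> skip v a = s i" using skip_eq by metis
      then show ?thesis unfolding s'_def by (rule theI')
    qed
    have eq: "S = skip v ` (s' ` {1..m})" using s s' by (force simp: image_image)
    moreover have "s' ` {1..m} \<in> occurrences m \<sigma> n \<pi>'"
      unfolding occurrences_def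
    proof (intro CollectI conjI exI[of _ s'])
      show "card (s' ` {1..m}) = m" using S(2) eq inj card_image by metis
      show "strict_mono_on {1..m} s'"
        using s(1) s' unfolding strict_mono_on_def by (metis skip_less_iff)
    qed (use s s' \<pi>' in auto)
    ultimately show "S \<in> (\<lambda>S. skip v ` S) ` occurrences m \<sigma> n \<pi>'" by blast
  qed
qed simp

definition max_density :: "nat \<Rightarrow> (nat \<Rightarrow> nat) \<Rightarrow> nat \<Rightarrow> real" where
  "max_density m \<sigma> n = Max (pattern_density m \<sigma> n ` {\<pi>. \<pi> permutes {1..n}})"

lemma pattern_density_le_max:
  "\<pi> permutes {1..n} \<Longrightarrow> pattern_density m \<sigma> n \<pi> \<le> max_density m \<sigma> n"
  unfolding max_density_def by (intro Max_ge) (auto simp: finite_permutations)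

lemma max_density_attained:
  obtains \<pi> where "\<pi> permutes {1..n}" "pattern_density m \<sigma> n \<pi> = max_density m \<sigma> n"
proof -
  have "max_density m \<sigma> n \<in> pattern_density m \<sigma> n ` {\<pi>. \<pi> permutes {1..n}}"
    unfolding max_density_def
    by (intro Max_in finite_imageI finite_permutations) (use permutes_id[of "{1..n}"] in blast)+
  then show thesis using that by auto
qed

lemma card_occurrences_le:
  assumes "\<pi> permutes {1..n}" "m \<le> n"
  shows "real (card (occurrences m \<sigma> n \<pi>)) \<le> max_density m \<sigma> n * real (n choose m)"
  using pattern_density_le_max[OF assms(1), of m \<sigma>] assms(2)
  by (simp add: pattern_density_def divide_le_eq)

text \<open>Averaging over the position \<open>v\<close> to be deleted.\<close>
lemma max_density_Suc_le:
  assumes "m \<le> n" shows "max_density m \<sigma> (Suc n) \<le> max_density m \<sigma> n"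
proof -
  obtain \<pi> where \<pi>: "\<pi> permutes {1..Suc n}" "pattern_density m \<sigma> (Suc n) \<pi> = max_density m \<sigma> (Suc n)"
    by (rule max_density_attained)
  let ?O = "occurrences m \<sigma> (Suc n) \<pi>"
  have inj: "\<pi> i = \<pi> j \<longleftrightarrow> i = j" for i j using permutes_inj[OF \<pi>(1)] by (auto dest: injD)
  have one: "real (card {S \<in> ?O. v \<notin> S}) \<le> max_density m \<sigma> n * real (n choose m)" if v: "v \<in> {1..Suc n}" for v
  proof -
    obtain \<pi>' where "\<pi>' permutes {1..n}"
      "\<And>i j. i \<in> {1..n} \<Longrightarrow> j \<in> {1..n} \<Longrightarrow> \<pi>' i < \<pi>' j \<longleftrightarrow> \<pi> (skip v i) < \<pi> (skip v j)"
    proof (rule ex_perm_of_order[of n "\<lambda>i j. \<pi> (skip v i) < \<pi> (skip v j)"])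
      show "\<pi> (skip v i) < \<pi> (skip v j) \<or> \<pi> (skip v j) < \<pi> (skip v i)" if "i \<noteq> j" for i j
        using that inj by (metis linorder_neq_iff skip_less_iff)
    qed auto
    then show ?thesis
      using occurrences_delete[OF v, of \<pi>' \<pi> m \<sigma>] card_occurrences_le[of \<pi>' n m \<sigma>] assms by force
  qed
  \<comment> \<open>Double counting of the pairs \<open>(v, S)\<close> with \<open>v\<close> outside
    \<open>S\<close>: every occurrence is avoided by \<open>Suc n - m\<close> positions.\<close>
  have "(\<Sum>v\<in>{1..Suc n}. card {S \<in> ?O. v \<notin> S}) = (\<Sum>S\<in>?O. card {v \<in> {1..Suc n}. v \<notin> S})"
    by (rule sum_multicount_gen) auto
  also have "\<dots> = (\<Sum>S\<in>?O. Suc n - m)"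
  proof (rule sum.cong[OF refl])
    fix S assume "S \<in> ?O"
    then have S: "S \<subseteq> {1..Suc n}" "card S = m" by (auto simp: occurrences_def)
    have "{v \<in> {1..Suc n}. v \<notin> S} = {1..Suc n} - S" by auto
    then show "card {v \<in> {1..Suc n}. v \<notin> S} = Suc n - m"
      using S finite_subset[OF S(1)] by (simp add: card_Diff_subset)
  qed
  finally have "real (card ?O * (Suc n - m)) = (\<Sum>v\<in>{1..Suc n}. real (card {S \<in> ?O. v \<notin> S}))"
    by (simp only: sum_constant of_nat_id of_nat_sum[symmetric])
  also have "\<dots> \<le> (\<Sum>v\<in>{1..Suc n}. max_density m \<sigma> n * real (n choose m))"
    by (intro sum_mono one)
  finally have le: "real (card ?O) * real (Suc n - m) \<le> real (Suc n) * (max_density m \<sigma> n * real (n choose m))"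
    by simp
  have "(Suc n - m) * (Suc n choose m) = Suc n * (n choose m)"
    using binomial_absorb_comp[of "Suc n" m] by simp
  then have "real (Suc n) * real (n choose m) = real (Suc n - m) * real (Suc n choose m)"
    by (metis of_nat_mult)
  with le have "real (Suc n - m) * real (card ?O) \<le> real (Suc n - m) * (max_density m \<sigma> n * real (Suc n choose m))"
    by (metis mult.left_commute mult.commute)
  moreover have "0 < real (Suc n - m)" using assms by simp
  ultimately have "real (card ?O) \<le> max_density m \<sigma> n * real (Suc n choose m)"
    by (metis mult_le_cancel_left_pos)
  moreover have "0 < real (Suc n choose m)" using assms by simp
  ultimately show ?thesis
    unfolding \<pi>(2)[symmetric] pattern_density_def by (simp add: divide_le_eq del: binomial_Suc_Suc)
qed

text \<open>\<open>lim\<close> is informative only for convergent sequences. The assumed lower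
  bound, together with monotonicity, yields convergence as well as the inequality.\<close>

lemma packing_density_ge:
  assumes "\<And>n. m \<le> n \<Longrightarrow> c \<le> max_density m \<sigma> n"
  shows "c \<le> packing_density m \<sigma>"
proof -
  \<comment> \<open>Shifted by \<open>m\<close>, since for \<open>n < m\<close> the density is 0 and
    monotonicity may fail.\<close>
  have "decseq (\<lambda>n. max_density m \<sigma> (n + m))"
    by (intro decseq_SucI) (simp add: max_density_Suc_le)
  then obtain L where "(\<lambda>n. max_density m \<sigma> (n + m)) \<longlonglongrightarrow> L"
    by (rule decseq_convergent[where B = c]) (use assms in simp)
  then have "convergent (\<lambda>n. max_density m \<sigma> (n + m))" by (rule convergentI)
  then have "convergent (max_density m \<sigma>)" by (simp add: convergent_ignore_initial_segment)
  then have "max_density m \<sigma> \<longlonglongrightarrow> packing_density m \<sigma>"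
    unfolding packing_density_def max_density_def by (simp add: convergent_LIMSEQ_iff)
  then show ?thesis
    by (rule LIMSEQ_le_const) (use assms in blast)
qed

section \<open>Independent samples\<close>

text \<open>The model is the law of the abscissa of a random point of the permuton, carried by the
  whole line so that monotone functions can be total. Without atoms, sample points are almost surely
  distinct.\<close>

locale atomless_prob = prob_space U for U :: "real measure" +
  assumes sets_U [measurable_cong]: "sets U = sets borel"
    and atomless: "measure U {x} = 0"
begin

abbreviation \<Omega> :: "'i set \<Rightarrow> ('i \<Rightarrow> real) measure" where
  "\<Omega> I \<equiv> Pi\<^sub>M I (\<lambda>_. U)"

lemma space_U [simp]: "space U = UNIV"
  using sets_eq_imp_space_eq[OF sets_U] by simp

lemma prob_space_\<Omega>: "prob_space (\<Omega> I)"
  by (intro prob_space_PiM prob_space_axioms)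

lemma product_prob_space_U: "product_prob_space (\<lambda>_. U)"
  by (rule product_prob_spaceI) (rule prob_space_axioms)

lemma measure_box:
  assumes "finite J" "J \<subseteq> I" "\<And>i. i \<in> J \<Longrightarrow> B i \<in> sets borel"
  shows "measure (\<Omega> I) {x \<in> space (\<Omega> I). \<forall>i\<in>J. x i \<in> B i} = (\<Prod>i\<in>J. measure U (B i))"
proof -
  have "emeasure (\<Omega> I) {x \<in> space (\<Omega> I). \<forall>i\<in>J. x i \<in> B i} = (\<Prod>i\<in>J. emeasure U (B i))"
    using assms by (intro product_prob_space.emeasure_PiM_Collect[OF product_prob_space_U]) (auto simp: sets_U)
  then have "ennreal (measure (\<Omega> I) {x \<in> space (\<Omega> I). \<forall>i\<in>J. x i \<in> B i}) = ennreal (\<Prod>i\<in>J. measure U (B i))"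
    using finite_measure.emeasure_eq_measure[OF prob_space.axioms(1)[OF prob_space_\<Omega>[of I]]]
    by (simp add: emeasure_eq_measure prod_ennreal)
  then show ?thesis by (simp add: prod_nonneg)
qed

text \<open>Serves both to single out \<open>m\<close> of \<open>n\<close> sample points and to
  permute a sample.\<close>

lemma measure_reindex:
  assumes "inj_on f I" "f \<in> I \<rightarrow> K" and [measurable]: "X \<in> sets (\<Omega> I)"
  shows "measure (\<Omega> K) {x \<in> space (\<Omega> K). (\<lambda>n\<in>I. x (f n)) \<in> X} = measure (\<Omega> I) X"
proof -
  have [measurable]: "(\<lambda>x. \<lambda>n\<in>I. x (f n)) \<in> \<Omega> K \<rightarrow>\<^sub>M \<Omega> I"
    using assms(2) by (intro measurable_restrict measurable_component_singleton) auto
  have "measure (\<Omega> I) X = measure (distr (\<Omega> K) (\<Omega> I) (\<lambda>x. \<lambda>n\<in>I. x (f n))) X"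
    by (subst distr_PiM_reindex[OF prob_space_axioms assms(1,2)]) simp
  also have "\<dots> = measure (\<Omega> K) {x \<in> space (\<Omega> K). (\<lambda>n\<in>I. x (f n)) \<in> X}"
    by (subst measure_distr) (auto intro!: arg_cong[of _ _ "measure (\<Omega> K)"])
  finally show ?thesis by simp
qed

text \<open>Overwriting the coordinates in \<open>S\<close> by those of a second independent sample
  preserves the law: the preimage of a box is a product of two boxes, and at each coordinate one of
  the two sides is the whole line.\<close>

lemma distr_merge_independent:
  assumes "finite I"
  shows "distr (\<Omega> I \<Otimes>\<^sub>M \<Omega> I) (\<Omega> I) (\<lambda>z. \<lambda>i\<in>I. if i \<in> S then snd z i else fst z i) = \<Omega> I"
    (is "distr ?P _ ?f = _")
proof -
  interpret product_sigma_finite "\<lambda>_. U"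
    by unfold_locales
  interpret O: prob_space "\<Omega> I" by (rule prob_space_\<Omega>)
  interpret OO: pair_prob_space "\<Omega> I" "\<Omega> I" ..
  have [measurable]: "?f \<in> ?P \<rightarrow>\<^sub>M \<Omega> I"
  proof (rule measurable_restrict)
    fix i assume "i \<in> I"
    then show "(\<lambda>z. if i \<in> S then snd z i else fst z i) \<in> ?P \<rightarrow>\<^sub>M U" by simp
  qed
  show ?thesis
  proof (rule PiM_eqI[OF assms])
    fix A assume A: "\<And>i. i \<in> I \<Longrightarrow> A i \<in> sets U"
    define X where "X = (\<Pi>\<^sub>E i\<in>I. if i \<in> S then UNIV else A i)"
    define Y where "Y = (\<Pi>\<^sub>E i\<in>I. if i \<in> S then A i else UNIV)"
    have XY: "X \<in> sets (\<Omega> I)" "Y \<in> sets (\<Omega> I)"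
      unfolding X_def Y_def using assms A by (auto intro!: sets_PiM_I_finite)
    have "Pi\<^sub>E I A \<in> sets (\<Omega> I)"
      using assms A by (auto intro!: sets_PiM_I_finite)
    then have "emeasure (distr ?P (\<Omega> I) ?f) (Pi\<^sub>E I A) = emeasure ?P (?f -` Pi\<^sub>E I A \<inter> space ?P)"
      by (rule emeasure_distr[rotated]) measurable
    also have "?f -` Pi\<^sub>E I A \<inter> space ?P = X \<times> Y"
      unfolding X_def Y_def space_pair_measure space_PiM
      by (auto simp: PiE_iff split: if_splits)
    also have "emeasure ?P (X \<times> Y) = emeasure (\<Omega> I) X * emeasure (\<Omega> I) Y"
      using XY by (rule O.emeasure_pair_measure_Times)
    also have "\<dots> = (\<Prod>i\<in>I. emeasure U (if i \<in> S then UNIV else A i)) * (\<Prod>i\<in>I. emeasure U (if i \<in> S then A i else UNIV))"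
      unfolding X_def Y_def using assms A by (subst (1 2) emeasure_PiM) auto
    also have "\<dots> = (\<Prod>i\<in>I. emeasure U (A i))"
      unfolding prod.distrib[symmetric] using emeasure_space_1 by (intro prod.cong) auto
    finally show "emeasure (distr ?P (\<Omega> I) ?f) (Pi\<^sub>E I A) = (\<Prod>i\<in>I. emeasure U (A i))" .
  qed simp
qed

lemma measure_merge_independent:
  assumes "finite I" and [measurable]: "G \<in> sets (\<Omega> I)"
  shows "measure (\<Omega> I \<Otimes>\<^sub>M \<Omega> I)
    {z \<in> space (\<Omega> I \<Otimes>\<^sub>M \<Omega> I). (\<lambda>i\<in>I. if i \<in> S then snd z i else fst z i) \<in> G} = measure (\<Omega> I) G"
    (is "measure ?P ?Z = _")
proof -
  let ?f = "\<lambda>z. \<lambda>i\<in>I. if i \<in> S then snd z i else fst z i"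
  have "?f \<in> ?P \<rightarrow>\<^sub>M \<Omega> I"
  proof (rule measurable_restrict)
    fix i assume "i \<in> I"
    then show "(\<lambda>z. if i \<in> S then snd z i else fst z i) \<in> ?P \<rightarrow>\<^sub>M U" by simp
  qed
  then have "measure (distr ?P (\<Omega> I) ?f) G = measure ?P (?f -` G \<inter> space ?P)"
    by (rule measure_distr) fact
  also have "?f -` G \<inter> space ?P = ?Z" by auto
  finally show ?thesis by (simp only: distr_merge_independent[OF assms(1)])
qed

lemma measure_pair_Times:
  assumes "N \<in> sets (\<Omega> I)" "X \<in> sets (\<Omega> I)"
  shows "measure (\<Omega> I \<Otimes>\<^sub>M \<Omega> I) (N \<times> X) = measure (\<Omega> I) N * measure (\<Omega> I) X"
proof -
  interpret O: prob_space "\<Omega> I" by (rule prob_space_\<Omega>)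
  show ?thesis
    using O.emeasure_pair_measure_Times[OF assms]
    by (simp add: measure_def enn2real_mult)
qed

text \<open>\<open>N\<close> may constrain the coordinates in \<open>S\<close> as well. They are
  overwritten by fresh values, and the product bound holds because \<open>N \<times> X\<close> lies
  in the preimage of \<open>G\<close>.\<close>

lemma measure_resample_ge:
  assumes "finite I" and [measurable]: "N \<in> sets (\<Omega> I)" "X \<in> sets (\<Omega> I)" "G \<in> sets (\<Omega> I)"
    and "\<And>x y. x \<in> N \<Longrightarrow> y \<in> X \<Longrightarrow> (\<lambda>i\<in>I. if i \<in> S then y i else x i) \<in> G"
  shows "measure (\<Omega> I) N * measure (\<Omega> I) X \<le> measure (\<Omega> I) G"
proof -
  interpret O: prob_space "\<Omega> I" by (rule prob_space_\<Omega>)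
  interpret OO: pair_prob_space "\<Omega> I" "\<Omega> I" ..
  have "measure (\<Omega> I \<Otimes>\<^sub>M \<Omega> I) (N \<times> X) \<le> measure (\<Omega> I \<Otimes>\<^sub>M \<Omega> I)
      {z \<in> space (\<Omega> I \<Otimes>\<^sub>M \<Omega> I). (\<lambda>i\<in>I. if i \<in> S then snd z i else fst z i) \<in> G}"
  proof (rule OO.finite_measure_mono)
    show "N \<times> X \<subseteq> {z \<in> space (\<Omega> I \<Otimes>\<^sub>M \<Omega> I). (\<lambda>i\<in>I. if i \<in> S then snd z i else fst z i) \<in> G}"
      using assms(5) sets.sets_into_space[OF assms(2)] sets.sets_into_space[OF assms(3)]
      by (auto simp: space_pair_measure)
  next
    have "(\<lambda>z. \<lambda>i\<in>I. if i \<in> S then snd z i else fst z i) \<in> (\<Omega> I \<Otimes>\<^sub>M \<Omega> I) \<rightarrow>\<^sub>M \<Omega> I"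
    proof (rule measurable_restrict)
      fix i assume "i \<in> I"
      then show "(\<lambda>z. if i \<in> S then snd z i else fst z i) \<in> (\<Omega> I \<Otimes>\<^sub>M \<Omega> I) \<rightarrow>\<^sub>M U" by simp
    qed
    then show "{z \<in> space (\<Omega> I \<Otimes>\<^sub>M \<Omega> I). (\<lambda>i\<in>I. if i \<in> S then snd z i else fst z i) \<in> G}
      \<in> sets (\<Omega> I \<Otimes>\<^sub>M \<Omega> I)"
      by measurable
  qed
  then show ?thesis
    by (simp add: measure_pair_Times measure_merge_independent[OF assms(1)])
qed

lemma measure_resample_eq:
  assumes "finite I" and "N \<in> sets (\<Omega> I)" "X \<in> sets (\<Omega> I)" "G \<in> sets (\<Omega> I)"
    and "\<And>x y. x \<in> space (\<Omega> I) \<Longrightarrow> y \<in> space (\<Omega> I) \<Longrightarrow>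
      (\<lambda>i\<in>I. if i \<in> S then y i else x i) \<in> G \<longleftrightarrow> x \<in> N \<and> y \<in> X"
  shows "measure (\<Omega> I) G = measure (\<Omega> I) N * measure (\<Omega> I) X"
proof -
  have "{z \<in> space (\<Omega> I \<Otimes>\<^sub>M \<Omega> I). (\<lambda>i\<in>I. if i \<in> S then snd z i else fst z i) \<in> G} = N \<times> X"
    (is "?L = _")
  proof (intro set_eqI)
    fix z
    show "z \<in> ?L \<longleftrightarrow> z \<in> N \<times> X"
      using assms(5)[of "fst z" "snd z"] sets.sets_into_space[OF assms(2)] sets.sets_into_space[OF assms(3)]
      unfolding space_pair_measure mem_Times_iff mem_Collect_eq by blast
  qed
  then show ?thesis
    using measure_merge_independent[OF assms(1,4), of S] measure_pair_Times[OF assms(2,3)] by simp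
qed

section \<open>Events about two coordinates of a sample\<close>

definition pair_prob :: "(real \<Rightarrow> real \<Rightarrow> bool) \<Rightarrow> real" where
  "pair_prob D = measure (U \<Otimes>\<^sub>M U) {z \<in> space (U \<Otimes>\<^sub>M U). D (fst z) (snd z)}"

lemma distr_pair_components:
  assumes "p \<in> I" "q \<in> I" "p \<noteq> q"
  shows "distr (\<Omega> I) (U \<Otimes>\<^sub>M U) (\<lambda>x. (x p, x q)) = U \<Otimes>\<^sub>M U"
proof (rule pair_measure_eqI[symmetric])
  have [measurable]: "(\<lambda>x. (x p, x q)) \<in> \<Omega> I \<rightarrow>\<^sub>M U \<Otimes>\<^sub>M U"
    using assms by measurable
  fix A B assume AB [measurable]: "A \<in> sets U" "B \<in> sets U"
  have "emeasure (distr (\<Omega> I) (U \<Otimes>\<^sub>M U) (\<lambda>x. (x p, x q))) (A \<times> B)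
      = emeasure (\<Omega> I) {x \<in> space (\<Omega> I). \<forall>i\<in>{p, q}. x i \<in> (if i = p then A else B)}"
    using assms by (subst emeasure_distr) (auto intro!: arg_cong[of _ _ "emeasure (\<Omega> I)"])
  also have "\<dots> = (\<Prod>i\<in>{p,q}. emeasure U (if i = p then A else B))"
    using assms AB by (intro product_prob_space.emeasure_PiM_Collect[OF product_prob_space_U]) auto
  also have "\<dots> = emeasure U A * emeasure U B" using assms by simp
  finally show "emeasure U A * emeasure U B = emeasure (distr (\<Omega> I) (U \<Otimes>\<^sub>M U) (\<lambda>x. (x p, x q))) (A \<times> B)" by simp
qed (simp_all add: sigma_finite_measure_axioms)

lemma measure_pair_components:
  assumes "p \<in> I" "q \<in> I" "p \<noteq> q"
    and [measurable]: "Measurable.pred (U \<Otimes>\<^sub>M U) (\<lambda>z. D (fst z) (snd z))"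
  shows "measure (\<Omega> I) {x \<in> space (\<Omega> I). D (x p) (x q)} = pair_prob D"
proof -
  have [measurable]: "(\<lambda>x. (x p, x q)) \<in> \<Omega> I \<rightarrow>\<^sub>M U \<Otimes>\<^sub>M U"
    using assms by measurable
  have "pair_prob D = measure (distr (\<Omega> I) (U \<Otimes>\<^sub>M U) (\<lambda>x. (x p, x q))) {z \<in> space (U \<Otimes>\<^sub>M U). D (fst z) (snd z)}"
    unfolding pair_prob_def by (simp add: distr_pair_components[OF assms(1-3)])
  also have "\<dots> = measure (\<Omega> I) {x \<in> space (\<Omega> I). D (x p) (x q)}"
  proof (subst measure_distr)
    show "{z \<in> space (U \<Otimes>\<^sub>M U). D (fst z) (snd z)} \<in> sets (U \<Otimes>\<^sub>M U)"
      using assms(4) by (simp only: pred_def)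
  qed (auto intro!: arg_cong[of _ _ "measure (\<Omega> I)"] simp: space_pair_measure)
  finally show ?thesis by simp
qed

text \<open>Resampling with \<open>S = {p, q}\<close> separates the condition on the pair from the
  conditions on \<open>J\<close>, which shows their independence.\<close>

lemma measure_pair_box:
  assumes "finite I" "p \<in> I" "q \<in> I" "p \<noteq> q"
    and [measurable]: "Measurable.pred (U \<Otimes>\<^sub>M U) (\<lambda>z. D (fst z) (snd z))"
    and J: "J \<subseteq> I - {p, q}" and B: "\<And>t. t \<in> J \<Longrightarrow> B t \<in> sets borel"
  shows "measure (\<Omega> I) {x \<in> space (\<Omega> I). D (x p) (x q) \<and> (\<forall>t\<in>J. x t \<in> B t)}
    = pair_prob D * (\<Prod>t\<in>J. measure U (B t))"
proof -
  have fin: "finite J" and JI: "J \<subseteq> I" using assms(1) J finite_subset[of J I] by auto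
  let ?X = "{x \<in> space (\<Omega> I). D (x p) (x q)}" and ?N = "{x \<in> space (\<Omega> I). \<forall>t\<in>J. x t \<in> B t}"
  let ?G = "{x \<in> space (\<Omega> I). D (x p) (x q) \<and> (\<forall>t\<in>J. x t \<in> B t)}"
  have [measurable]: "(\<lambda>x. (x p, x q)) \<in> \<Omega> I \<rightarrow>\<^sub>M U \<Otimes>\<^sub>M U"
    using assms by measurable
  have [measurable]: "Measurable.pred (\<Omega> I) (\<lambda>x. D (x p) (x q))"
    using measurable_compose[OF \<open>(\<lambda>x. (x p, x q)) \<in> \<Omega> I \<rightarrow>\<^sub>M U \<Otimes>\<^sub>M U\<close> assms(5)] by simp
  have [measurable]: "Measurable.pred (\<Omega> I) (\<lambda>x. \<forall>t\<in>J. x t \<in> B t)"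
  proof (rule pred_intros_finite(3)[OF fin])
    fix t assume t: "t \<in> J"
    then have "(\<lambda>x. x t) \<in> \<Omega> I \<rightarrow>\<^sub>M U" using JI by (intro measurable_component_singleton) auto
    then show "Measurable.pred (\<Omega> I) (\<lambda>x. x t \<in> B t)" using B[OF t] by (intro pred_sets2) (auto simp: sets_U)
  qed
  have "measure (\<Omega> I) ?G = measure (\<Omega> I) ?N * measure (\<Omega> I) ?X"
  proof (rule measure_resample_eq[OF assms(1), where S = "{p, q}"])
    fix x y assume xy: "x \<in> space (\<Omega> I)" "y \<in> space (\<Omega> I)"
    have "(\<lambda>i\<in>I. if i \<in> {p, q} then y i else x i) \<in> space (\<Omega> I)"
      using xy by (auto simp: space_PiM PiE_iff)
    moreover have "(\<lambda>i\<in>I. if i \<in> {p, q} then y i else x i) t = x t" if "t \<in> J" for t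
      using that J by auto
    moreover have "(\<lambda>i\<in>I. if i \<in> {p, q} then y i else x i) p = y p"
      "(\<lambda>i\<in>I. if i \<in> {p, q} then y i else x i) q = y q" using assms by auto
    ultimately show "(\<lambda>i\<in>I. if i \<in> {p, q} then y i else x i) \<in> ?G \<longleftrightarrow> x \<in> ?N \<and> y \<in> ?X"
      using xy by (simp only: mem_Collect_eq cong: ball_cong) blast
  qed measurable
  then show ?thesis
    using measure_box[OF fin JI B] measure_pair_components[OF assms(2-5)] by simp
qed

lemma pair_prob_Times:
  assumes "A \<in> sets borel" "B \<in> sets borel"
  shows "pair_prob (\<lambda>x y. x \<in> A \<and> y \<in> B) = measure U A * measure U B"
proof -
  have "{z \<in> space (U \<Otimes>\<^sub>M U). fst z \<in> A \<and> snd z \<in> B} = A \<times> B"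
    by (auto simp: space_pair_measure)
  then show ?thesis
    unfolding pair_prob_def using assms emeasure_pair_measure_Times[of A U B]
    by (simp add: measure_def enn2real_mult sets_U)
qed

lemma pair_prob_mono:
  assumes "\<And>x y. D x y \<Longrightarrow> D' x y" "Measurable.pred (U \<Otimes>\<^sub>M U) (\<lambda>z. D' (fst z) (snd z))"
  shows "pair_prob D \<le> pair_prob D'"
proof -
  interpret UU: pair_prob_space U U ..
  have "{z \<in> space (U \<Otimes>\<^sub>M U). D' (fst z) (snd z)} \<in> sets (U \<Otimes>\<^sub>M U)"
    using assms(2) by (simp only: pred_def)
  then show ?thesis unfolding pair_prob_def
    by (rule UU.finite_measure_mono[rotated]) (use assms(1) in blast)
qed

text \<open>By Fubini: once the first point is fixed, the second has to hit a level set of measure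
  zero. The set \<open>V\<close> allows two uses: the identity with all values, and \<open>g\<close>
  with the values in a null stretch.\<close>

lemma AE_pair_level:
  fixes g :: "real \<Rightarrow> real"
  assumes [measurable]: "g \<in> borel_measurable borel" "V \<in> sets borel"
    and null: "\<And>v. v \<in> V \<Longrightarrow> measure U {x. g x = v} = 0"
    and pq: "p \<in> I" "q \<in> I" "p \<noteq> q"
  shows "AE x in \<Omega> I. \<not> (g (x p) = g (x q) \<and> g (x p) \<in> V)"
proof -
  interpret UU: pair_prob_space U U ..
  have g [measurable]: "g \<in> borel_measurable U" by (simp cong: measurable_cong_sets add: sets_U)
  have "AE z in U \<Otimes>\<^sub>M U. \<not> (g (fst z) = g (snd z) \<and> g (fst z) \<in> V)"
  proof (rule UU.AE_pair_measure)
    show "{x \<in> space (U \<Otimes>\<^sub>M U). \<not> (g (fst x) = g (snd x) \<and> g (fst x) \<in> V)} \<in> sets (U \<Otimes>\<^sub>M U)"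
      by measurable
    have "AE y in U. \<not> (g a = g y \<and> g a \<in> V)" for a
    proof (cases "g a \<in> V")
      case True
      have "{x. g x = g a} \<in> null_sets U"
        using null[OF True] by (intro null_setsI) (auto simp: emeasure_eq_measure sets_U)
      then have "AE y in U. y \<notin> {x. g x = g a}" by (rule AE_not_in)
      then show ?thesis by eventually_elim auto
    qed simp
    then show "AE x in U. AE y in U. \<not> (g (fst (x, y)) = g (snd (x, y)) \<and> g (fst (x, y)) \<in> V)" by simp
  qed
  then have "AE z in distr (\<Omega> I) (U \<Otimes>\<^sub>M U) (\<lambda>x. (x p, x q)). \<not> (g (fst z) = g (snd z) \<and> g (fst z) \<in> V)"
    by (simp only: distr_pair_components[OF pq])
  moreover have "(\<lambda>x. (x p, x q)) \<in> \<Omega> I \<rightarrow>\<^sub>M U \<Otimes>\<^sub>M U" using pq by measurable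
  ultimately have "AE x in \<Omega> I. \<not> (g (fst (x p, x q)) = g (snd (x p, x q)) \<and> g (fst (x p, x q)) \<in> V)"
    by (rule AE_distrD[rotated])
  then show ?thesis by simp
qed

lemma AE_distinct:
  assumes "finite I"
  shows "AE x in \<Omega> I. inj_on x I"
proof -
  have "AE x in \<Omega> I. \<forall>p\<in>I. \<forall>q\<in>I. p \<noteq> q \<longrightarrow> x p \<noteq> x q"
  proof (intro AE_finite_allI[OF assms] )
    fix p q assume "p \<in> I" "q \<in> I"
    then show "AE x in \<Omega> I. p \<noteq> q \<longrightarrow> x p \<noteq> x q"
      using AE_pair_level[of "\<lambda>x. x" UNIV p I q] by (cases "p = q") (auto simp: atomless)
  qed
  then show ?thesis by eventually_elim (auto simp: inj_on_def)
qed

end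

section \<open>Block patterns in samples\<close>

text \<open>The index of an element can be read off from the range alone, as exactly
  \<open>i - 1\<close> elements of the range lie below the \<open>i\<close>-th.\<close>

lemma strict_mono_on_image_eq:
  fixes s t :: "nat \<Rightarrow> 'a::linorder"
  assumes s: "strict_mono_on {1..m} s" and t: "strict_mono_on {1..m} t"
    and eq: "s ` {1..m} = t ` {1..m}" and i: "i \<in> {1..m}"
  shows "s i = t i"
proof -
  have rank: "card {a \<in> f ` {1..m}. a < f i} = i - 1"
    if f: "strict_mono_on {1..m} f" and i: "i \<in> {1..m}" for f :: "nat \<Rightarrow> 'a" and i
  proof -
    have less: "f a < f c \<longleftrightarrow> a < c" if "a \<in> {1..m}" "c \<in> {1..m}" for a c
      using strict_mono_on_less[OF f that] .
    have "{a \<in> f ` {1..m}. a < f i} = f ` {1..<i}"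
    proof (intro set_eqI iffI)
      fix y assume "y \<in> {a \<in> f ` {1..m}. a < f i}"
      then obtain a where "a \<in> {1..m}" "y = f a" "f a < f i" by blast
      then show "y \<in> f ` {1..<i}" using less[of a i] i by auto
    next
      fix y assume "y \<in> f ` {1..<i}"
      then obtain a where a: "a \<in> {1..<i}" "y = f a" by blast
      then have "a \<in> {1..m}" using i by auto
      then show "y \<in> {a \<in> f ` {1..m}. a < f i}" using less[of a i] a i by auto
    qed
    moreover have "inj_on f {1..<i}"
      using strict_mono_on_imp_inj_on[OF f] i by (auto intro: inj_on_subset)
    ultimately show ?thesis by (simp add: card_image)
  qed
  obtain j where j: "j \<in> {1..m}" "s i = t j" using eq i by blast
  have "i - 1 = j - 1"
    using rank[OF s i] rank[OF t j(1)] eq j(2) by simp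
  then have "i = j" using i j(1) by auto
  then show ?thesis using j(2) by simp
qed

text \<open>\<open>\<rho> i\<close> is the rank of \<open>x i\<close>, so the inverse of
  \<open>\<rho>\<close> lists the points in increasing order.\<close>

lemma sorting_permutation:
  fixes x :: "nat \<Rightarrow> 'a::linorder"
  assumes "inj_on x {1..n}"
  obtains \<rho> where "\<rho> permutes {1..n}"
    "\<And>i j. i \<in> {1..n} \<Longrightarrow> j \<in> {1..n} \<Longrightarrow> \<rho> i < \<rho> j \<longleftrightarrow> x i < x j"
proof (rule ex_perm_of_order[of n "\<lambda>i j. x i < x j"])
  show "x i < x j \<or> x j < x i" if "i \<in> {1..n}" "j \<in> {1..n}" "i \<noteq> j" for i j
    using inj_onD[OF assms, of i j] that by (metis linorder_neq_iff)
qed (auto intro: that less_trans)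

text \<open>A monotone sequence is determined by the cardinalities of its sublevel sets, and
  permuting the indices preserves these.\<close>

lemma mono_permuted_eq:
  fixes b :: "nat \<Rightarrow> nat"
  assumes \<rho>: "\<rho> permutes {1..m}"
    and b: "\<And>i j. i \<in> {1..m} \<Longrightarrow> j \<in> {1..m} \<Longrightarrow> i \<le> j \<Longrightarrow> b i \<le> b j"
    and b\<rho>: "\<And>i j. i \<in> {1..m} \<Longrightarrow> j \<in> {1..m} \<Longrightarrow> i \<le> j \<Longrightarrow> b (\<rho> i) \<le> b (\<rho> j)"
    and i: "i \<in> {1..m}"
  shows "b (\<rho> i) = b i"
proof -
  have not_less: "\<not> f i < g i"
    if f: "\<And>i j. i \<in> {1..m} \<Longrightarrow> j \<in> {1..m} \<Longrightarrow> i \<le> j \<Longrightarrow> f i \<le> f j"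
      and g: "\<And>i j. i \<in> {1..m} \<Longrightarrow> j \<in> {1..m} \<Longrightarrow> i \<le> j \<Longrightarrow> g i \<le> g j"
      and card: "\<And>v. card {a \<in> {1..m}. f a \<le> v} = card {a \<in> {1..m}. g a \<le> v}"
    for f g :: "nat \<Rightarrow> nat"
  proof
    assume less: "f i < g i"
    have "{1..i} \<subseteq> {a \<in> {1..m}. f a \<le> f i}" using f i by auto
    then have "card {1..i} \<le> card {a \<in> {1..m}. f a \<le> f i}" by (intro card_mono) auto
    also have "\<dots> = card {a \<in> {1..m}. g a \<le> f i}" by (rule card)
    also have "\<dots> \<le> card {1..<i}"
    proof (intro card_mono subsetI)
      fix a assume a: "a \<in> {a \<in> {1..m}. g a \<le> f i}"
      then have "\<not> i \<le> a" using g[of i a] i less by auto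
      then show "a \<in> {1..<i}" using a by auto
    qed simp
    finally show False using i by auto
  qed
  have card: "card {a \<in> {1..m}. b (\<rho> a) \<le> v} = card {a \<in> {1..m}. b a \<le> v}" for v
  proof -
    have "\<rho> ` {a \<in> {1..m}. b (\<rho> a) \<le> v} = {a \<in> {1..m}. b a \<le> v}"
    proof (intro set_eqI iffI)
      fix y assume "y \<in> \<rho> ` {a \<in> {1..m}. b (\<rho> a) \<le> v}"
      then show "y \<in> {a \<in> {1..m}. b a \<le> v}" using permutes_in_image[OF \<rho>] by auto
    next
      fix y assume y: "y \<in> {a \<in> {1..m}. b a \<le> v}"
      then obtain a where "a \<in> {1..m}" "y = \<rho> a" using permutes_image[OF \<rho>] by blast
      then show "y \<in> \<rho> ` {a \<in> {1..m}. b (\<rho> a) \<le> v}" using y by auto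
    qed
    then show ?thesis
      using card_image[OF inj_on_subset[OF permutes_inj[OF \<rho>]], of "{a \<in> {1..m}. b (\<rho> a) \<le> v}"] by simp
  qed
  have "\<not> b (\<rho> i) < b i" by (rule not_less) (fact b b\<rho> card)+
  moreover have "\<not> b i < b (\<rho> i)" by (rule not_less[of b "\<lambda>i. b (\<rho> i)"]) (fact b b\<rho> card[symmetric])+
  ultimately show ?thesis by simp
qed

text \<open>\<open>b i\<close> is the index of the layer of the pattern that contains position
  \<open>i\<close>.\<close>

locale block_structure = atomless_prob U for U +
  fixes k m :: nat and b :: "nat \<Rightarrow> nat"
  assumes b_range: "i \<in> {1..m} \<Longrightarrow> b i \<in> {1..k}"
    and b_onto: "j \<in> {1..k} \<Longrightarrow> \<exists>i\<in>{1..m}. b i = j"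
    and b_mono: "i \<in> {1..m} \<Longrightarrow> j \<in> {1..m} \<Longrightarrow> i \<le> j \<Longrightarrow> b i \<le> b j"
begin

text \<open>The equivalence also applies with \<open>i\<close> and \<open>j\<close> exchanged and
  therefore forces the points of one block to share a level.\<close>

definition E :: "(real \<Rightarrow> real) \<Rightarrow> (nat \<Rightarrow> real) set" where
  "E h = {x \<in> space (\<Omega> {1..m}). \<forall>i\<in>{1..m}. \<forall>j\<in>{1..m}. h (x i) < h (x j) \<longleftrightarrow> b i < b j}"

text \<open>Densities lead to sorted samples. The modifications below would destroy sortedness, so
  they are carried out in \<open>E\<close>.\<close>

definition Q :: "(real \<Rightarrow> real) \<Rightarrow> (nat \<Rightarrow> real) set" where
  "Q h = {x \<in> E h. strict_mono_on {1..m} x}"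

lemma component_measurable:
  "i \<in> I \<Longrightarrow> (\<lambda>x. x i) \<in> borel_measurable (\<Omega> I)"
  using measurable_component_singleton[of i I "\<lambda>_. U"] by (simp cong: measurable_cong_sets add: sets_U)

lemma mono_component_measurable:
  fixes h :: "real \<Rightarrow> real"
  assumes "mono h" "i \<in> I"
  shows "(\<lambda>x. h (x i)) \<in> borel_measurable (\<Omega> I)"
  by (rule measurable_compose[OF component_measurable[OF assms(2)] borel_measurable_mono[OF assms(1)]])

lemma E_measurable:
  assumes "mono h" shows "E h \<in> sets (\<Omega> {1..m})"
  unfolding E_def
proof (intro sets.sets_Collect_finite_All finite_atLeastAtMost)
  fix i j assume ij: "i \<in> {1..m}" "j \<in> {1..m}"
  note [measurable] = mono_component_measurable[OF assms ij(1)] mono_component_measurable[OF assms ij(2)]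
  show "{x \<in> space (\<Omega> {1..m}). (h (x i) < h (x j)) = (b i < b j)} \<in> sets (\<Omega> {1..m})"
    by measurable
qed

lemma Q_measurable:
  assumes "mono h" shows "Q h \<in> sets (\<Omega> {1..m})"
proof -
  have "{x \<in> space (\<Omega> {1..m}). \<forall>i\<in>{1..m}. \<forall>j\<in>{1..m}. i < j \<longrightarrow> x i < x j} \<in> sets (\<Omega> {1..m})"
  proof (intro sets.sets_Collect_finite_All finite_atLeastAtMost)
    fix i j assume ij: "i \<in> {1..m}" "j \<in> {1..m}"
    note [measurable] = component_measurable[OF ij(1)] component_measurable[OF ij(2)]
    show "{x \<in> space (\<Omega> {1..m}). i < j \<longrightarrow> x i < x j} \<in> sets (\<Omega> {1..m})"
      by measurable
  qed
  then have "E h \<inter> {x \<in> space (\<Omega> {1..m}). \<forall>i\<in>{1..m}. \<forall>j\<in>{1..m}. i < j \<longrightarrow> x i < x j} \<in> sets (\<Omega> {1..m})"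
    by (rule sets.Int[OF E_measurable[OF assms]])
  also have "E h \<inter> {x \<in> space (\<Omega> {1..m}). \<forall>i\<in>{1..m}. \<forall>j\<in>{1..m}. i < j \<longrightarrow> x i < x j} = Q h"
    unfolding Q_def strict_mono_on_def E_def by blast
  finally show ?thesis .
qed

text \<open>The Young subgroup of the block sizes. Its order is the factor between \<open>E\<close>
  and \<open>Q\<close> and is the same for every \<open>h\<close>, so both events have the same
  maximisers.\<close>

definition block_perms :: "(nat \<Rightarrow> nat) set" where
  "block_perms = {\<rho>. \<rho> permutes {1..m} \<and> (\<forall>i\<in>{1..m}. b (\<rho> i) = b i)}"

lemma finite_block_perms: "finite block_perms"
  unfolding block_perms_def by (rule finite_subset[OF _ finite_permutations[of "{1..m}"]]) auto

lemma reindexed_Q_measurable: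
  assumes "mono h" "f \<in> {1..m} \<rightarrow> I"
  shows "{x \<in> space (\<Omega> I). (\<lambda>n\<in>{1..m}. x (f n)) \<in> Q h} \<in> sets (\<Omega> I)"
proof -
  note [measurable] = Q_measurable[OF assms(1)]
  have [measurable]: "(\<lambda>x. \<lambda>n\<in>{1..m}. x (f n)) \<in> \<Omega> I \<rightarrow>\<^sub>M \<Omega> {1..m}"
    using assms(2) by (intro measurable_restrict measurable_component_singleton) auto
  show ?thesis by measurable
qed

lemma reindexed_mem_E_iff:
  assumes "f \<in> {1..m} \<rightarrow> I" "x \<in> space (\<Omega> I)"
  shows "(\<lambda>n\<in>{1..m}. x (f n)) \<in> E h \<longleftrightarrow>
    (\<forall>i\<in>{1..m}. \<forall>j\<in>{1..m}. h (x (f i)) < h (x (f j)) \<longleftrightarrow> b i < b j)"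
  using assms unfolding E_def by (auto simp: space_PiM)

text \<open>Almost every point of \<open>E h\<close> is sorted by exactly one permutation, and that permutation preserves the blocks.\<close>
lemma measure_E_eq:
  assumes h: "mono h"
  shows "measure (\<Omega> {1..m}) (E h) = real (card block_perms) * measure (\<Omega> {1..m}) (Q h)"
proof -
  interpret O: prob_space "\<Omega> {1..m}" by (rule prob_space_\<Omega>)
  let ?A = "\<lambda>\<rho>. {x \<in> space (\<Omega> {1..m}). (\<lambda>n\<in>{1..m}. x (\<rho> n)) \<in> Q h}"
  have perm: "\<rho> \<in> {1..m} \<rightarrow> {1..m}" if "\<rho> \<in> block_perms" for \<rho>
    using that permutes_in_image[of \<rho> "{1..m}"] by (auto simp: block_perms_def)
  have A: "?A \<rho> \<in> sets (\<Omega> {1..m})" if "\<rho> \<in> block_perms" for \<rho>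
    by (rule reindexed_Q_measurable[OF h perm[OF that]])
  have "AE x in \<Omega> {1..m}. x \<in> E h \<longleftrightarrow> x \<in> (\<Union>\<rho>\<in>block_perms. ?A \<rho>)"
    using AE_distinct[OF finite_atLeastAtMost, of 1 m] AE_space
  proof eventually_elim
    case (elim x)
    show ?case
    proof
      assume x: "x \<in> E h"
      obtain r where r: "r permutes {1..m}"
        "\<And>i j. i \<in> {1..m} \<Longrightarrow> j \<in> {1..m} \<Longrightarrow> r i < r j \<longleftrightarrow> x i < x j"
        using sorting_permutation[OF elim(1)] by blast
      define \<rho> where "\<rho> = inv r"
      have \<rho>: "\<rho> permutes {1..m}" unfolding \<rho>_def by (rule permutes_inv[OF r(1)])
      have in\<rho>: "\<rho> i \<in> {1..m}" if "i \<in> {1..m}" for i using permutes_in_image[OF \<rho>] that by simp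
      have less: "x (\<rho> i) < x (\<rho> j) \<longleftrightarrow> i < j" if "i \<in> {1..m}" "j \<in> {1..m}" for i j
        using r(2)[OF in\<rho>[OF that(1)] in\<rho>[OF that(2)]] permutes_inverses[OF r(1)] by (simp add: \<rho>_def)
      have E: "h (x i) < h (x j) \<longleftrightarrow> b i < b j" if "i \<in> {1..m}" "j \<in> {1..m}" for i j
        using x that by (simp add: E_def)
      \<comment> \<open>After sorting, the levels are monotone because \<open>h\<close> is. So
        \<open>b\<close> composed with \<open>\<rho>\<close> is monotone, and
        \<open>mono_permuted_eq\<close> identifies it with \<open>b\<close>.\<close>
      have b\<rho>: "b (\<rho> i) = b i" if "i \<in> {1..m}" for i
      proof (rule mono_permuted_eq[OF \<rho> b_mono _ that])
        fix i j assume ij: "i \<in> {1..m}" "j \<in> {1..m}" "i \<le> j"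
        show "b (\<rho> i) \<le> b (\<rho> j)"
        proof (rule ccontr)
          assume "\<not> b (\<rho> i) \<le> b (\<rho> j)"
          then have "h (x (\<rho> j)) < h (x (\<rho> i))" using E[OF in\<rho>[OF ij(2)] in\<rho>[OF ij(1)]] by simp
          then have "x (\<rho> j) < x (\<rho> i)" using monoD[OF h, of "x (\<rho> i)" "x (\<rho> j)"] by linarith
          then show False using less[OF ij(2,1)] ij(3) by simp
        qed
      qed
      have "(\<lambda>n\<in>{1..m}. x (\<rho> n)) \<in> Q h"
        unfolding Q_def mem_Collect_eq
      proof
        show "(\<lambda>n\<in>{1..m}. x (\<rho> n)) \<in> E h"
          using in\<rho> elim(2) E b\<rho> by (subst reindexed_mem_E_iff[of _ "{1..m}"]) auto
        show "strict_mono_on {1..m} (\<lambda>n\<in>{1..m}. x (\<rho> n))"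
          by (rule strict_mono_onI) (use less in auto)
      qed
      then show "x \<in> (\<Union>\<rho>\<in>block_perms. ?A \<rho>)"
        using \<rho> b\<rho> elim(2) unfolding block_perms_def by blast
    next
      assume "x \<in> (\<Union>\<rho>\<in>block_perms. ?A \<rho>)"
      then obtain \<rho> where \<rho>: "\<rho> \<in> block_perms" and x: "(\<lambda>n\<in>{1..m}. x (\<rho> n)) \<in> Q h" by blast
      have E: "h (x (\<rho> i)) < h (x (\<rho> j)) \<longleftrightarrow> b i < b j" if "i \<in> {1..m}" "j \<in> {1..m}" for i j
        using x reindexed_mem_E_iff[OF perm[OF \<rho>] elim(2)] that unfolding Q_def by blast
      have ex: "\<exists>i'\<in>{1..m}. i = \<rho> i' \<and> b i' = b i" if "i \<in> {1..m}" for i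
      proof -
        have "i \<in> \<rho> ` {1..m}"
          using \<rho> that permutes_image[of \<rho> "{1..m}"] unfolding block_perms_def by blast
        then obtain i' where "i' \<in> {1..m}" "i = \<rho> i'" by blast
        then show ?thesis using \<rho> unfolding block_perms_def by auto
      qed
      show "x \<in> E h"
        unfolding E_def mem_Collect_eq
      proof (intro conjI ballI)
        fix i j assume "i \<in> {1..m}" "j \<in> {1..m}"
        then obtain i' j' where "i' \<in> {1..m}" "i = \<rho> i'" "b i' = b i" "j' \<in> {1..m}" "j = \<rho> j'" "b j' = b j"
          using ex by meson
        then show "h (x i) < h (x j) \<longleftrightarrow> b i < b j" using E[of i' j'] by simp
      qed (rule elim(2))
    qed
  qed
  then have "measure (\<Omega> {1..m}) (E h) = measure (\<Omega> {1..m}) (\<Union>\<rho>\<in>block_perms. ?A \<rho>)"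
    using A finite_block_perms by (intro O.finite_measure_eq_AE E_measurable[OF h] sets.finite_UN) auto
  also have "\<dots> = (\<Sum>\<rho>\<in>block_perms. measure (\<Omega> {1..m}) (?A \<rho>))"
  proof (rule O.finite_measure_finite_Union[OF finite_block_perms])
    show "?A ` block_perms \<subseteq> sets (\<Omega> {1..m})" using A by blast
    show "disjoint_family_on ?A block_perms"
    proof (unfold disjoint_family_on_def, intro ballI impI, rule ccontr)
      fix \<rho> \<rho>' assume \<rho>: "\<rho> \<in> block_perms" "\<rho>' \<in> block_perms" "\<rho> \<noteq> \<rho>'" and ne: "?A \<rho> \<inter> ?A \<rho>' \<noteq> {}"
      from ne obtain x where "x \<in> ?A \<rho>" "x \<in> ?A \<rho>'" by blast
      then have x: "strict_mono_on {1..m} (\<lambda>n\<in>{1..m}. x (\<rho> n))"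
        "strict_mono_on {1..m} (\<lambda>n\<in>{1..m}. x (\<rho>' n))"
        unfolding Q_def by simp_all
      have p: "\<rho> permutes {1..m}" "\<rho>' permutes {1..m}" using \<rho> by (auto simp: block_perms_def)
      \<comment> \<open>Both reindexings list the same values increasingly, hence agree; as the
        values are distinct, the permutations agree.\<close>
      have "(\<lambda>n\<in>{1..m}. x (\<rho> n)) ` {1..m} = x ` (\<rho> ` {1..m})" by auto
      also have "\<dots> = x ` (\<rho>' ` {1..m})" by (simp only: permutes_image[OF p(1)] permutes_image[OF p(2)])
      also have "\<dots> = (\<lambda>n\<in>{1..m}. x (\<rho>' n)) ` {1..m}" by auto
      finally have eq: "x (\<rho> n) = x (\<rho>' n)" if "n \<in> {1..m}" for n
        using strict_mono_on_image_eq[OF x _ that] that by simp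
      have "inj_on (\<lambda>n\<in>{1..m}. x (\<rho> n)) {1..m}" by (rule strict_mono_on_imp_inj_on[OF x(1)])
      then have inj: "inj_on x {1..m}"
      proof -
        assume inj: "inj_on (\<lambda>n\<in>{1..m}. x (\<rho> n)) {1..m}"
        have "inj_on x (\<rho> ` {1..m})"
        proof (rule inj_onI, elim imageE)
          fix y y' i i' assume *: "x y = x y'" "y = \<rho> i" "y' = \<rho> i'" "i \<in> {1..m}" "i' \<in> {1..m}"
          then have "i = i'" using inj_onD[OF inj, of i i'] by simp
          then show "y = y'" using * by simp
        qed
        then show ?thesis by (simp only: permutes_image[OF p(1)])
      qed
      have "\<rho> n = \<rho>' n" for n
      proof (cases "n \<in> {1..m}")
        case True
        show ?thesis
          by (rule inj_onD[OF inj eq[OF True]]) (use True permutes_in_image[OF p(1)] permutes_in_image[OF p(2)] in simp_all)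
      next
        case False
        then show ?thesis using permutes_not_in[OF p(1)] permutes_not_in[OF p(2)] by simp
      qed
      then show False using \<rho>(3) by blast
    qed
  qed
  also have "\<dots> = (\<Sum>\<rho>\<in>block_perms. measure (\<Omega> {1..m}) (Q h))"
  proof (rule sum.cong[OF refl])
    fix \<rho> assume \<rho>: "\<rho> \<in> block_perms"
    then have "inj_on \<rho> {1..m}" by (auto simp: block_perms_def intro: inj_on_subset[OF permutes_inj])
    then show "measure (\<Omega> {1..m}) (?A \<rho>) = measure (\<Omega> {1..m}) (Q h)"
      by (rule measure_reindex[OF _ perm[OF \<rho>] Q_measurable[OF h]])
  qed
  finally show ?thesis by simp
qed

text \<open>One sample of \<open>n\<close> points yields one permutation of order \<open>n\<close>,
  and each pair \<open>(S, \<rho>)\<close> of the set yields an occurrence of the pattern in it.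
  Different pairs yield different occurrences, since at most one \<open>\<rho>\<close> sorts the
  points indexed by \<open>S\<close>.\<close>

lemma occurrence_count:
  assumes h: "mono h" and mn: "m \<le> n" and x: "x \<in> space (\<Omega> {1..n})" "inj_on x {1..n}"
    and \<sigma>: "\<And>i j. i \<in> {1..m} \<Longrightarrow> j \<in> {1..m} \<Longrightarrow> \<sigma> i < \<sigma> j \<longleftrightarrow> b i < b j \<or> b i = b j \<and> j < i"
    and e: "\<And>S. S \<subseteq> {1..n} \<Longrightarrow> card S = m \<Longrightarrow> bij_betw (e S) {1..m} S"
  shows "real (card {(S, \<rho>). S \<subseteq> {1..n} \<and> card S = m \<and> \<rho> permutes {1..m} \<and>
      (\<lambda>i\<in>{1..m}. x (e S (\<rho> i))) \<in> Q h}) \<le> max_density m \<sigma> n * real (n choose m)"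
    (is "real (card ?T) \<le> _")
proof -
  obtain r where r: "r permutes {1..n}"
    "\<And>i j. i \<in> {1..n} \<Longrightarrow> j \<in> {1..n} \<Longrightarrow> r i < r j \<longleftrightarrow> x i < x j"
    using sorting_permutation[OF x(2)] by blast
  \<comment> \<open>\<open>y a\<close> is the \<open>a\<close>-th smallest sample point.\<close>
  define y where "y a = x (inv r a)" for a
  have yr: "y (r i) = x i" for i by (simp add: y_def permutes_inverses[OF r(1)])
  \<comment> \<open>Positions are compared by level, and in reverse within a level: each level
    becomes a decreasing layer.\<close>
  obtain \<pi> where \<pi>: "\<pi> permutes {1..n}"
    "\<And>a c. a \<in> {1..n} \<Longrightarrow> c \<in> {1..n} \<Longrightarrow> \<pi> a < \<pi> c \<longleftrightarrow> h (y a) < h (y c) \<or> h (y a) = h (y c) \<and> c < a"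
    by (rule ex_perm_of_order[of n "\<lambda>a c. h (y a) < h (y c) \<or> h (y a) = h (y c) \<and> c < a"])
      (auto intro: less_trans)
  \<comment> \<open>For a pair in the set, \<open>\<rho>\<close> followed by \<open>e S\<close> and
    \<open>r\<close> is the increasing enumeration of the positions occupied by
    \<open>S\<close>.\<close>
  have T: "(\<lambda>i. r (e S (\<rho> i))) ` {1..m} = r ` S \<and> strict_mono_on {1..m} (\<lambda>i. r (e S (\<rho> i))) \<and>
      (\<forall>i\<in>{1..m}. e S (\<rho> i) \<in> S)
      \<and> (\<forall>i\<in>{1..m}. \<forall>j\<in>{1..m}. h (x (e S (\<rho> i))) < h (x (e S (\<rho> j))) \<longleftrightarrow> b i < b j)"
    if S: "S \<subseteq> {1..n}" "card S = m" and \<rho>: "\<rho> permutes {1..m}"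
      and q: "(\<lambda>i\<in>{1..m}. x (e S (\<rho> i))) \<in> Q h" for S \<rho>
  proof (intro conjI)
    have in\<rho>: "\<rho> i \<in> {1..m}" if "i \<in> {1..m}" for i using permutes_in_image[OF \<rho>] that by simp
    have eS: "e S ` {1..m} = S" using e[OF S] by (rule bij_betw_imp_surj_on)
    have "(\<lambda>i. r (e S (\<rho> i))) ` {1..m} = r ` e S ` \<rho> ` {1..m}" by (simp only: image_image)
    then show "(\<lambda>i. r (e S (\<rho> i))) ` {1..m} = r ` S" by (simp only: permutes_image[OF \<rho>] eS)
    show in_S: "\<forall>i\<in>{1..m}. e S (\<rho> i) \<in> S" using eS in\<rho> by blast
    have "strict_mono_on {1..m} (\<lambda>i\<in>{1..m}. x (e S (\<rho> i)))" using q by (simp add: Q_def)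
    then have "x (e S (\<rho> i)) < x (e S (\<rho> j))" if "i \<in> {1..m}" "j \<in> {1..m}" "i < j" for i j
      using strict_mono_onD[of "{1..m}" "\<lambda>i\<in>{1..m}. x (e S (\<rho> i))" i j] that by simp
    then show "strict_mono_on {1..m} (\<lambda>i. r (e S (\<rho> i)))"
      using r(2) in_S S(1) by (intro strict_mono_onI) blast
    have "(\<lambda>i\<in>{1..m}. x (e S (\<rho> i))) \<in> E h" using q by (simp add: Q_def)
    moreover have "(\<lambda>i. e S (\<rho> i)) \<in> {1..m} \<rightarrow> {1..n}" using in_S S(1) by blast
    ultimately show "\<forall>i\<in>{1..m}. \<forall>j\<in>{1..m}. h (x (e S (\<rho> i))) < h (x (e S (\<rho> j))) \<longleftrightarrow> b i < b j"
      using reindexed_mem_E_iff[of "\<lambda>i. e S (\<rho> i)" "{1..n}" x h] x(1) by blast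
  qed
  have "card ?T \<le> card (occurrences m \<sigma> n \<pi>)"
  proof (rule card_inj_on_le[where f = "\<lambda>(S, \<rho>). r ` S"])
    show "inj_on (\<lambda>(S, \<rho>). r ` S) ?T"
    proof (rule inj_onI)
      fix z z' assume z: "z \<in> ?T" "z' \<in> ?T" "(case z of (S, \<rho>) \<Rightarrow> r ` S) = (case z' of (S, \<rho>) \<Rightarrow> r ` S)"
      obtain S \<rho> S' \<rho>' where zz: "z = (S, \<rho>)" "z' = (S', \<rho>')" by (metis surj_pair)
      have S: "S \<subseteq> {1..n}" "card S = m" and \<rho>: "\<rho> permutes {1..m}"
        and q: "(\<lambda>i\<in>{1..m}. x (e S (\<rho> i))) \<in> Q h"
        and \<rho>': "\<rho>' permutes {1..m}"
        and q': "(\<lambda>i\<in>{1..m}. x (e S' (\<rho>' i))) \<in> Q h" and eq: "r ` S = r ` S'"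
        using z unfolding zz mem_Collect_eq case_prod_conv by blast+
      have [simp]: "S' = S" using eq permutes_inj[OF r(1)] by (simp add: inj_image_eq_iff)
      have t: "r (e S (\<rho> i)) = r (e S (\<rho>' i))" if "i \<in> {1..m}" for i
        by (rule strict_mono_on_image_eq[of m "\<lambda>i. r (e S (\<rho> i))" "\<lambda>i. r (e S (\<rho>' i))"])
          (use T[OF S \<rho> q] T[OF S \<rho>'] q' that in simp_all)
      have "\<rho> i = \<rho>' i" for i
      proof (cases "i \<in> {1..m}")
        case True
        have "e S (\<rho> i) = e S (\<rho>' i)" using t[OF True] permutes_inj[OF r(1)] by (simp add: inj_eq)
        then show ?thesis
          by (rule inj_onD[OF bij_betw_imp_inj_on[OF e[OF S]]])
            (use True permutes_in_image[OF \<rho>] permutes_in_image[OF \<rho>'] in simp_all)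
      next
        case False
        then show ?thesis using permutes_not_in[OF \<rho>] permutes_not_in[OF \<rho>'] by simp
      qed
      then show "z = z'" by (auto simp: zz)
    qed
    show "(\<lambda>(S, \<rho>). r ` S) ` ?T \<subseteq> occurrences m \<sigma> n \<pi>"
    proof (rule image_subsetI)
      fix z assume z: "z \<in> ?T"
      obtain S \<rho> where zz: "z = (S, \<rho>)" by (metis surj_pair)
      have S: "S \<subseteq> {1..n}" "card S = m" and \<rho>: "\<rho> permutes {1..m}"
        and q: "(\<lambda>i\<in>{1..m}. x (e S (\<rho> i))) \<in> Q h"
        using z unfolding zz mem_Collect_eq case_prod_conv by blast+
      let ?s = "\<lambda>i. r (e S (\<rho> i))"
      note T = T[OF S \<rho> q]
      have mono: "?s i < ?s j \<longleftrightarrow> i < j" if "i \<in> {1..m}" "j \<in> {1..m}" for i j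
        using strict_mono_on_less[of "{1..m}" ?s i j] T that by blast
      have rn: "r a \<in> {1..n}" if "a \<in> {1..n}" for a using permutes_in_image[OF r(1)] that by simp
      have *: "\<sigma> i < \<sigma> j \<longleftrightarrow> \<pi> (?s i) < \<pi> (?s j)" if ij: "i \<in> {1..m}" "j \<in> {1..m}" for i j
      proof -
        have hb: "h (x (e S (\<rho> i))) < h (x (e S (\<rho> j))) \<longleftrightarrow> b i < b j"
          "h (x (e S (\<rho> j))) < h (x (e S (\<rho> i))) \<longleftrightarrow> b j < b i" using T ij by blast+
        have "?s i \<in> {1..n}" "?s j \<in> {1..n}" using T ij S(1) rn by blast+
        then show ?thesis
          using \<sigma>[OF ij] \<pi>(2)[of "?s i" "?s j"] hb mono[OF ij(2,1)] unfolding yr by linarith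
      qed
      show "(case z of (S, \<rho>) \<Rightarrow> r ` S) \<in> occurrences m \<sigma> n \<pi>"
        unfolding zz case_prod_conv occurrences_def mem_Collect_eq
      proof (intro conjI exI[of _ ?s] ballI)
        show "\<sigma> i < \<sigma> j \<longleftrightarrow> \<pi> (?s i) < \<pi> (?s j)" if "i \<in> {1..m}" "j \<in> {1..m}" for i j
          by (rule *[OF that])
        show "r ` S \<subseteq> {1..n}" using S(1) rn by blast
        show "card (r ` S) = m" using S(2) card_image[OF inj_on_subset[OF permutes_inj[OF r(1)]], of S] by simp
      qed (use T in blast)+
    qed
  qed simp
  then show ?thesis using card_occurrences_le[OF \<pi>(1) mn, of \<sigma>] by linarith
qed

text \<open>First moment method: for \<open>n\<close> independent points, the number of pairs in
  \<open>occurrence_count\<close> has expectation \<open>(n choose m) * fact m\<close> times the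
  probability of \<open>Q h\<close>, and almost surely it is at most
  \<open>max_density m \<sigma> n * (n choose m)\<close>.\<close>

lemma fact_measure_Q_le_packing_density:
  assumes h: "mono h"
    and \<sigma>: "\<And>i j. i \<in> {1..m} \<Longrightarrow> j \<in> {1..m} \<Longrightarrow> \<sigma> i < \<sigma> j \<longleftrightarrow> b i < b j \<or> b i = b j \<and> j < i"
  shows "fact m * measure (\<Omega> {1..m}) (Q h) \<le> packing_density m \<sigma>"
proof (rule packing_density_ge)
  fix n assume mn: "m \<le> n"
  interpret O: prob_space "\<Omega> {1..n}" by (rule prob_space_\<Omega>)
  \<comment> \<open>The enumeration \<open>e S\<close> is fixed before sampling; sorting is left to
    \<open>\<rho>\<close>, which ranges over all permutations.\<close>
  have "\<forall>S. \<exists>f. S \<subseteq> {1..n} \<longrightarrow> card S = m \<longrightarrow> bij_betw f {1..m} S"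
  proof (intro allI)
    fix S show "\<exists>f. S \<subseteq> {1..n} \<longrightarrow> card S = m \<longrightarrow> bij_betw f {1..m} S"
    proof (cases "S \<subseteq> {1..n} \<and> card S = m")
      case True
      then have "finite S" "card {1..m} = card S" using finite_subset by auto
      then show ?thesis using finite_same_card_bij[of "{1..m}" S] by auto
    qed auto
  qed
  then obtain e where e: "bij_betw (e S) {1..m} S" if "S \<subseteq> {1..n}" "card S = m" for S :: "nat set"
    by metis
  define T where "T = {S. S \<subseteq> {1..n} \<and> card S = m} \<times> {\<rho>. \<rho> permutes {1..m}}"
  define A where "A = (\<lambda>(S, \<rho>). {x \<in> space (\<Omega> {1..n}). (\<lambda>i\<in>{1..m}. x (e S (\<rho> i))) \<in> Q h})"
  let ?M = "max_density m \<sigma> n * real (n choose m)"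
  have finT: "finite T" unfolding T_def by (simp add: finite_permutations)
  have cardT: "card T = (n choose m) * fact m"
    unfolding T_def using n_subsets[of "{1..n}" m] card_permutations[of "{1..m}" m]
    by (simp add: card_cartesian_product)
  have f: "(\<lambda>i. e S (\<rho> i)) \<in> {1..m} \<rightarrow> {1..n}" "inj_on (\<lambda>i. e S (\<rho> i)) {1..m}"
    if "(S, \<rho>) \<in> T" for S \<rho>
  proof -
    have S: "S \<subseteq> {1..n}" "card S = m" and \<rho>: "\<rho> permutes {1..m}" using that by (auto simp: T_def)
    have \<rho>': "\<rho> ` {1..m} = {1..m}" by (rule permutes_image[OF \<rho>])
    show "(\<lambda>i. e S (\<rho> i)) \<in> {1..m} \<rightarrow> {1..n}"
      using bij_betw_imp_surj_on[OF e[OF S]] \<rho>' S(1) by blast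
    have "inj_on (e S \<circ> \<rho>) {1..m}"
      by (rule comp_inj_on[OF inj_on_subset[OF permutes_inj[OF \<rho>] subset_UNIV]])
        (simp only: \<rho>' bij_betw_imp_inj_on[OF e[OF S]])
    then show "inj_on (\<lambda>i. e S (\<rho> i)) {1..m}" by (simp add: comp_def)
  qed
  have A: "A p \<in> sets (\<Omega> {1..n})" "measure (\<Omega> {1..n}) (A p) = measure (\<Omega> {1..m}) (Q h)" if "p \<in> T" for p
  proof -
    obtain S \<rho> where p: "p = (S, \<rho>)" by (cases p)
    note f = f[OF that[unfolded p]]
    show "A p \<in> sets (\<Omega> {1..n})" unfolding A_def p case_prod_conv by (rule reindexed_Q_measurable[OF h f(1)])
    show "measure (\<Omega> {1..n}) (A p) = measure (\<Omega> {1..m}) (Q h)"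
      unfolding A_def p case_prod_conv by (rule measure_reindex[OF f(2,1) Q_measurable[OF h]])
  qed
  have int: "integrable (\<Omega> {1..n}) (indicator (A p) :: _ \<Rightarrow> real)" if "p \<in> T" for p
    by (rule integrable_real_indicator[OF A(1)[OF that]]) (simp only: O.emeasure_eq_measure, simp)
  have "real (card T) * measure (\<Omega> {1..m}) (Q h) = (\<Sum>p\<in>T. measure (\<Omega> {1..n}) (A p))"
    using A(2) by simp
  also have "\<dots> = (\<Sum>p\<in>T. \<integral>x. indicator (A p) x \<partial>\<Omega> {1..n})"
    using A(1) by (intro sum.cong refl) (simp add: sets.Int_space_eq2)
  also have "\<dots> = (\<integral>x. (\<Sum>p\<in>T. indicator (A p) x) \<partial>\<Omega> {1..n})"
    by (rule Bochner_Integration.integral_sum[symmetric]) (rule int)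
  also have "\<dots> \<le> (\<integral>x. ?M \<partial>\<Omega> {1..n})"
  proof (rule integral_mono_AE)
    show "integrable (\<Omega> {1..n}) (\<lambda>x. \<Sum>p\<in>T. indicator (A p) x :: real)"
      by (rule Bochner_Integration.integrable_sum) (rule int)
    show "AE x in \<Omega> {1..n}. (\<Sum>p\<in>T. indicator (A p) x) \<le> ?M"
      using AE_distinct[OF finite_atLeastAtMost, of 1 n] AE_space
    proof eventually_elim
      case (elim x)
      have "(\<Sum>p\<in>T. indicator (A p) x :: real) = real (card {p \<in> T. x \<in> A p})"
        using finT by (simp add: indicator_def sum.If_cases Int_def)
      also have "{p \<in> T. x \<in> A p} = {(S, \<rho>). S \<subseteq> {1..n} \<and> card S = m \<and> \<rho> permutes {1..m} \<and>
          (\<lambda>i\<in>{1..m}. x (e S (\<rho> i))) \<in> Q h}"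
        using elim(2) by (auto simp: T_def A_def)
      also have "real (card \<dots>) \<le> ?M"
        by (rule occurrence_count[OF h mn elim(2,1) \<sigma> e])
      finally show ?case .
    qed
  qed (rule O.integrable_const)
  also have "\<dots> = ?M" using O.prob_space by simp
  finally have "real (n choose m) * (fact m * measure (\<Omega> {1..m}) (Q h)) \<le> real (n choose m) * max_density m \<sigma> n"
    unfolding cardT by (simp add: mult.assoc mult.commute[of "real (n choose m)" "max_density m \<sigma> n"])
  then show "fact m * measure (\<Omega> {1..m}) (Q h) \<le> max_density m \<sigma> n"
    using mn by (simp add: mult_le_cancel_left_pos)
qed

section \<open>Improving a maximiser\<close>

definition block_size :: "nat \<Rightarrow> nat" where
  "block_size j = card {t \<in> {1..m}. b t = j}"

lemma level_set_borel: "mono g \<Longrightarrow> {x. P (g x)} \<in> sets borel" if "{y. P y} \<in> sets borel"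
  for g :: "real \<Rightarrow> real"
  using measurable_sets[OF borel_measurable_mono that, of g] by (simp add: vimage_def)

lemma pred_pair:
  fixes g :: "real \<Rightarrow> real"
  assumes g: "mono g"
  shows "Measurable.pred (U \<Otimes>\<^sub>M U) (\<lambda>z. \<alpha> \<le> g (fst z) \<and> g (fst z) < g (snd z) \<and> g (snd z) \<le> \<beta>)"
proof -
  have g' [measurable]: "g \<in> borel_measurable U"
    using borel_measurable_mono[OF g] by (simp cong: measurable_cong_sets add: sets_U)
  have [measurable]: "(\<lambda>z. g (fst z)) \<in> borel_measurable (U \<Otimes>\<^sub>M U)" "(\<lambda>z. g (snd z)) \<in> borel_measurable (U \<Otimes>\<^sub>M U)"
    by (rule measurable_compose[OF measurable_fst g'] measurable_compose[OF measurable_snd g'])+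
  show ?thesis by measurable
qed

section \<open>Merging a stretch of levels\<close>

definition split_prob :: "(real \<Rightarrow> real) \<Rightarrow> real \<Rightarrow> real \<Rightarrow> real" where
  "split_prob g \<alpha> \<beta> = pair_prob (\<lambda>x y. \<alpha> \<le> g x \<and> g x < g y \<and> g y \<le> \<beta>)"

text \<open>Acts on levels rather than on points, so that its composition with \<open>g\<close> is
  again monotone and hence a competitor.\<close>

definition merge :: "real \<Rightarrow> real \<Rightarrow> real \<Rightarrow> real" where
  "merge \<alpha> \<beta> t = (if \<alpha> \<le> t \<and> t \<le> \<beta> then \<alpha> else t)"

lemma mono_merge: "mono (merge \<alpha> \<beta>)"
  by (rule monoI) (auto simp: merge_def)

lemma box_measurable:
  assumes "\<And>t. t \<in> J \<Longrightarrow> B t \<in> sets borel" "J \<subseteq> {1..m}"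
  shows "{x \<in> space (\<Omega> {1..m}). \<forall>t\<in>J. x t \<in> B t} \<in> sets (\<Omega> {1..m})"
proof (intro sets.sets_Collect_finite_All)
  show "finite J" using assms(2) finite_subset by blast
  fix t assume t: "t \<in> J"
  have "(\<lambda>x. x t) -` B t \<inter> space (\<Omega> {1..m}) \<in> sets (\<Omega> {1..m})"
    using t assms by (intro measurable_sets[OF component_measurable]) auto
  also have "(\<lambda>x. x t) -` B t \<inter> space (\<Omega> {1..m}) = {x \<in> space (\<Omega> {1..m}). x t \<in> B t}" by auto
  finally show "{x \<in> space (\<Omega> {1..m}). x t \<in> B t} \<in> sets (\<Omega> {1..m})" .
qed

lemma pair_box_measurable:
  fixes g :: "real \<Rightarrow> real"
  assumes g: "mono g" and pq: "p \<in> {1..m}" "q \<in> {1..m}"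
    and "\<And>t. t \<in> J \<Longrightarrow> B t \<in> sets borel" "J \<subseteq> {1..m}"
  shows "{x \<in> space (\<Omega> {1..m}). (\<alpha> \<le> g (x p) \<and> g (x p) < g (x q) \<and> g (x q) \<le> \<beta>) \<and> (\<forall>t\<in>J. x t \<in> B t)}
    \<in> sets (\<Omega> {1..m})"
proof -
  note [measurable] = mono_component_measurable[OF g pq(1)] mono_component_measurable[OF g pq(2)]
  have "{x \<in> space (\<Omega> {1..m}). \<alpha> \<le> g (x p) \<and> g (x p) < g (x q) \<and> g (x q) \<le> \<beta>} \<in> sets (\<Omega> {1..m})"
    by measurable
  moreover have "{x \<in> space (\<Omega> {1..m}). \<forall>t\<in>J. x t \<in> B t} \<in> sets (\<Omega> {1..m})"
    by (rule box_measurable) (use assms(4,5) in auto)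
  ultimately show ?thesis by (rule sets.sets_Collect_conj[rotated])
qed

text \<open>
  Merging everything between the levels \<open>\<alpha>\<close> and \<open>\<beta>\<close> into one layer destroys only configurations that
  use two different levels in \<open>[\<alpha>, \<beta>]\<close> for two adjacent blocks, and creates configurations in which
  the block \<open>j\<close> uses two such levels. Both probabilities contain the factor \<open>split_prob\<close>.
\<close>
lemma merge_bound:
  assumes g: "mono g" and opt: "\<And>h. mono h \<Longrightarrow> measure (\<Omega> {1..m}) (E h) \<le> measure (\<Omega> {1..m}) (E g)"
    and j: "j \<in> {1..k}" "block_size j \<ge> 2"
    and adj: "\<And>i. i \<in> {1..<k} \<Longrightarrow> block_size j + 1 \<le> block_size i + block_size (i + 1)"
    and \<alpha>\<beta>: "\<alpha> \<le> \<beta>" and split: "split_prob g \<alpha> \<beta> > 0"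
    and below: "\<And>i. i \<in> {1..k} \<Longrightarrow> i < j \<Longrightarrow> u i < \<alpha>"
    and above: "\<And>i. i \<in> {1..k} \<Longrightarrow> j < i \<Longrightarrow> \<beta> < u i"
    and mono_u: "\<And>i i'. i \<in> {1..k} - {j} \<Longrightarrow> i' \<in> {1..k} - {j} \<Longrightarrow> i < i' \<Longrightarrow> u i < u i'"
  shows "(\<Prod>t\<in>{t \<in> {1..m}. b t \<noteq> j}. measure U {x. g x = u (b t)}) \<le> real k * measure U {x. \<alpha> \<le> g x \<and> g x \<le> \<beta>}"
proof -
  interpret O: prob_space "\<Omega> {1..m}" by (rule prob_space_\<Omega>)
  let ?\<mu> = "measure (\<Omega> {1..m})"
  define A where "A = {x. \<alpha> \<le> g x \<and> g x \<le> \<beta>}"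
  define s where "s = measure U A"
  define pp where "pp = split_prob g \<alpha> \<beta>"
  let ?D = "\<lambda>x y. \<alpha> \<le> g x \<and> g x < g y \<and> g y \<le> \<beta>"
  let ?h = "\<lambda>x. merge \<alpha> \<beta> (g x)"
  have h: "mono ?h" using g mono_merge by (auto simp: mono_def)
  have [simp]: "A \<in> sets borel" unfolding A_def by (rule level_set_borel[OF _ g]) measurable
  have lev [simp]: "{x. g x = v} \<in> sets borel" for v by (rule level_set_borel[OF _ g]) simp
  have s: "0 \<le> s" "s \<le> 1" unfolding s_def by simp_all
  have pp: "pp > 0" using split by (simp add: pp_def)
  have s_pos: "s > 0"
  proof (rule ccontr)
    assume "\<not> s > 0"
    then have "s = 0" using s by simp
    have "pp \<le> pair_prob (\<lambda>x y. x \<in> A \<and> y \<in> A)"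
      unfolding pp_def split_prob_def
    proof (rule pair_prob_mono)
      have [measurable]: "A \<in> sets U" by (simp add: sets_U)
      show "Measurable.pred (U \<Otimes>\<^sub>M U) (\<lambda>z. fst z \<in> A \<and> snd z \<in> A)" by measurable
    qed (auto simp: A_def)
    also have "\<dots> = 0" using \<open>s = 0\<close> pair_prob_Times[of A A] by (simp add: s_def)
    finally show False using pp by simp
  qed

  obtain p q where pq: "p \<in> {1..m}" "q \<in> {1..m}" "p \<noteq> q" "b p = j" "b q = j"
  proof -
    have "\<not> card {t \<in> {1..m}. b t = j} \<le> 1" using j(2) by (simp add: block_size_def)
    then obtain p q where "p \<in> {t \<in> {1..m}. b t = j}" "q \<in> {t \<in> {1..m}. b t = j}" "p \<noteq> q"
      using card_le_Suc0_iff_eq[of "{t \<in> {1..m}. b t = j}"] by auto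
    then show thesis using that by blast
  qed
  define B where "B t = (if b t = j then A else {x. g x = u (b t)})" for t
  define J where "J = {1..m} - {p, q}"
  \<comment> \<open>The gained configurations: block \<open>j\<close> lies in the stretch, with
    \<open>p\<close> and \<open>q\<close> on different levels, which \<open>E g\<close> forbids and
    the merge repairs. The other blocks lie on the levels \<open>u i\<close>.\<close>
  define G where "G = {x \<in> space (\<Omega> {1..m}). ?D (x p) (x q) \<and> (\<forall>t\<in>J. x t \<in> B t)}"
  define c where "c = (\<Prod>t\<in>{t \<in> {1..m}. b t \<noteq> j}. measure U {x. g x = u (b t)})"
  have B: "B t \<in> sets borel" for t by (simp add: B_def)
  have G_sets: "G \<in> sets (\<Omega> {1..m})"
    unfolding G_def by (rule pair_box_measurable[OF g pq(1,2)]) (auto simp: B J_def)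
  have "J = ({t \<in> {1..m}. b t = j} - {p, q}) \<union> {t \<in> {1..m}. b t \<noteq> j}" using pq by (auto simp: J_def)
  then have "(\<Prod>t\<in>J. measure U (B t)) =
      (\<Prod>t\<in>{t \<in> {1..m}. b t = j} - {p, q}. measure U (B t)) * (\<Prod>t\<in>{t \<in> {1..m}. b t \<noteq> j}. measure U (B t))"
    by (simp only:) (rule prod.union_disjoint; auto)
  also have "(\<Prod>t\<in>{t \<in> {1..m}. b t = j} - {p, q}. measure U (B t)) = s ^ (block_size j - 2)"
    using pq by (simp add: B_def s_def block_size_def card_Diff_subset numeral_2_eq_2)
  also have "(\<Prod>t\<in>{t \<in> {1..m}. b t \<noteq> j}. measure U (B t)) = c"
    unfolding c_def by (rule prod.cong) (auto simp: B_def)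
  finally have \<mu>G: "?\<mu> G = pp * (s ^ (block_size j - 2) * c)"
    unfolding G_def pp_def split_prob_def
    using measure_pair_box[OF finite_atLeastAtMost pq(1-3) pred_pair[OF g, of \<alpha> \<beta>], of J B] B by (simp add: J_def)
  have G_h: "G \<subseteq> E ?h"
  proof
    fix x assume x: "x \<in> G"
    define w where "w i = (if i = j then \<alpha> else u i)" for i
    have w: "w i < w i'" if "i \<in> {1..k}" "i' \<in> {1..k}" "i < i'" for i i'
      using below[of i] above[of i'] mono_u[of i i'] that \<alpha>\<beta> by (auto simp: w_def)
    have hw: "?h (x t) = w (b t)" if t: "t \<in> {1..m}" for t
    proof (cases "b t = j")
      case True
      have "x t \<in> A"
      proof (cases "t = p \<or> t = q")
        case True
        then show ?thesis using x by (auto simp: G_def A_def)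
      next
        case False
        then have "x t \<in> B t" using x t unfolding G_def J_def by blast
        then show ?thesis using \<open>b t = j\<close> by (simp add: B_def)
      qed
      then show ?thesis using True by (simp add: A_def merge_def w_def)
    next
      case False
      then have "t \<in> J" using t pq by (auto simp: J_def)
      then have "x t \<in> B t" using x unfolding G_def by blast
      then have "g (x t) = u (b t)" using False by (simp add: B_def)
      moreover have "u (b t) < \<alpha> \<or> \<beta> < u (b t)"
        using False below[of "b t"] above[of "b t"] b_range[OF t] by linarith
      ultimately show ?thesis using False by (auto simp: merge_def w_def)
    qed
    show "x \<in> E ?h"
      unfolding E_def mem_Collect_eq
    proof (intro conjI ballI)
      show "x \<in> space (\<Omega> {1..m})" using x by (simp add: G_def)
      fix i i' assume i: "i \<in> {1..m}" "i' \<in> {1..m}"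
      show "?h (x i) < ?h (x i') \<longleftrightarrow> b i < b i'"
        unfolding hw[OF i(1)] hw[OF i(2)]
        using w[of "b i" "b i'"] w[of "b i'" "b i"] b_range[OF i(1)] b_range[OF i(2)]
        by (metis less_asym less_irrefl linorder_neq_iff)
    qed
  qed
  have G_g: "G \<inter> E g = {}"
    using pq unfolding G_def E_def by fastforce

  have "\<forall>i. \<exists>p. i \<in> {1..k} \<longrightarrow> p \<in> {1..m} \<and> b p = i" using b_onto by blast
  then obtain r where r: "r i \<in> {1..m}" "b (r i) = i" if "i \<in> {1..k}" for i by metis
  \<comment> \<open>The configurations that may be lost: blocks \<open>i\<close> and
    \<open>i + 1\<close> lie in the stretch. Asking for different levels at the representatives only
    produces the same factor \<open>pp\<close> as in \<open>G\<close>.\<close>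
  define Z where "Z i = {x \<in> space (\<Omega> {1..m}). ?D (x (r i)) (x (r (i + 1))) \<and>
    (\<forall>t\<in>{t \<in> {1..m}. b t = i \<or> b t = i + 1} - {r i, r (i + 1)}. x t \<in> A)}" for i
  have Z: "Z i \<in> sets (\<Omega> {1..m})" "?\<mu> (Z i) \<le> pp * s ^ (block_size j - 1)" if i: "i \<in> {1..<k}" for i
  proof -
    have i': "i \<in> {1..k}" "i + 1 \<in> {1..k}" using i by auto
    note ri = r[OF i'(1)] r[OF i'(2)]
    have ne: "r i \<noteq> r (i + 1)" using ri by (metis add_cancel_right_right one_neq_zero)
    show "Z i \<in> sets (\<Omega> {1..m})"
      unfolding Z_def by (rule pair_box_measurable[OF g ri(1,3)]) auto
    let ?J = "{t \<in> {1..m}. b t = i \<or> b t = i + 1}"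
    have "?J = {t \<in> {1..m}. b t = i} \<union> {t \<in> {1..m}. b t = i + 1}" by auto
    then have "card ?J = block_size i + block_size (i + 1)"
      unfolding block_size_def by (simp only:) (rule card_Un_disjoint; auto)
    then have card: "card (?J - {r i, r (i + 1)}) = block_size i + block_size (i + 1) - 2"
      using ri ne by (simp add: card_Diff_subset)
    have "?\<mu> (Z i) = pp * s ^ (block_size i + block_size (i + 1) - 2)"
      unfolding Z_def pp_def split_prob_def
      by (subst measure_pair_box[OF finite_atLeastAtMost ri(1,3) ne pred_pair[OF g]])
        (auto simp: card[simplified] s_def)
    \<comment> \<open>As \<open>s \<le> 1\<close>, the assumption \<open>adj\<close> permits
      lowering the exponent to \<open>block_size j - 1\<close>, which is still one more than in
      \<open>G\<close>.\<close>
    also have "\<dots> \<le> pp * s ^ (block_size j - 1)"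
      using adj[OF i] s pp by (intro mult_left_mono power_decreasing) auto
    finally show "?\<mu> (Z i) \<le> pp * s ^ (block_size j - 1)" .
  qed
  have cover: "E g \<subseteq> (E g \<inter> E ?h) \<union> (\<Union>i\<in>{1..<k}. Z i)"
  proof
    fix x assume x: "x \<in> E g"
    then have Eg: "g (x t) < g (x t') \<longleftrightarrow> b t < b t'" if "t \<in> {1..m}" "t' \<in> {1..m}" for t t'
      using that by (simp add: E_def)
    show "x \<in> (E g \<inter> E ?h) \<union> (\<Union>i\<in>{1..<k}. Z i)"
    proof (cases "x \<in> E ?h")
      case False
      then obtain t t' where t: "t \<in> {1..m}" "t' \<in> {1..m}" and ne: "\<not> (?h (x t) < ?h (x t') \<longleftrightarrow> b t < b t')"
        using x unfolding E_def by blast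
      have "b t < b t'"
        using ne Eg[OF t] monoD[OF mono_merge[of \<alpha> \<beta>], of "g (x t')" "g (x t)"] by linarith
      then have lt: "g (x t) < g (x t')" "\<not> ?h (x t) < ?h (x t')" using ne Eg[OF t] by auto
      then have ab: "\<alpha> \<le> g (x t)" "g (x t') \<le> \<beta>" by (auto simp: merge_def split: if_splits)
      \<comment> \<open>When the merge identifies levels of blocks \<open>b t < b t'\<close>, all
        blocks between them are squeezed into the stretch, in particular \<open>b t\<close> and its
        successor.\<close>
      define i where "i = b t"
      have i: "i \<in> {1..<k}" using \<open>b t < b t'\<close> b_range[OF t(1)] b_range[OF t(2)] by (auto simp: i_def)
      then have i': "i \<in> {1..k}" "i + 1 \<in> {1..k}" by auto
      have inA: "x t'' \<in> A" if "t'' \<in> {1..m}" "b t'' = i \<or> b t'' = i + 1" for t''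
        using Eg[OF that(1) t(1)] Eg[OF t(2) that(1)] that(2) \<open>b t < b t'\<close> ab unfolding i_def A_def by auto
      have "?D (x (r i)) (x (r (i + 1)))"
        using inA[OF r(1)[OF i'(1)]] inA[OF r(1)[OF i'(2)]] r(2)[OF i'(1)] r(2)[OF i'(2)]
          Eg[OF r(1)[OF i'(1)] r(1)[OF i'(2)]] by (auto simp: A_def)
      moreover have "x \<in> space (\<Omega> {1..m})" using x by (simp add: E_def)
      ultimately have "x \<in> Z i" using inA unfolding Z_def by blast
      then show ?thesis using i by blast
    qed (use x in blast)
  qed
  have "?\<mu> (E g) \<le> ?\<mu> ((E g \<inter> E ?h) \<union> (\<Union>i\<in>{1..<k}. Z i))"
    using Z(1) E_measurable[OF g] E_measurable[OF h] by (intro O.finite_measure_mono cover) auto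
  also have "\<dots> \<le> ?\<mu> (E g \<inter> E ?h) + ?\<mu> (\<Union>i\<in>{1..<k}. Z i)"
    using Z(1) E_measurable[OF g] E_measurable[OF h] by (intro measure_Un_le) auto
  also have "?\<mu> (\<Union>i\<in>{1..<k}. Z i) \<le> (\<Sum>i\<in>{1..<k}. ?\<mu> (Z i))"
    using Z(1) by (intro O.finite_measure_subadditive_finite) auto
  also have "\<dots> \<le> (\<Sum>i\<in>{1..<k}. pp * s ^ (block_size j - 1))" by (intro sum_mono Z(2))
  also have "\<dots> \<le> real k * (pp * s ^ (block_size j - 1))"
    using pp s by (simp add: mult_right_mono)
  finally have 1: "?\<mu> (E g) \<le> ?\<mu> (E g \<inter> E ?h) + real k * (pp * s ^ (block_size j - 1))" by simp
  \<comment> \<open>\<open>G\<close> is disjoint from the surviving part of \<open>E g\<close>, so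
    by optimality its measure is at most that of the lost part.\<close>
  have "?\<mu> G + ?\<mu> (E g \<inter> E ?h) = ?\<mu> (G \<union> (E g \<inter> E ?h))"
    using G_sets G_g E_measurable[OF g] E_measurable[OF h]
    by (intro O.finite_measure_Union[symmetric]) auto
  also have "\<dots> \<le> ?\<mu> (E ?h)"
    using G_h E_measurable[OF h] by (intro O.finite_measure_mono) auto
  also have "\<dots> \<le> ?\<mu> (E g)" by (rule opt[OF h])
  finally have "?\<mu> G \<le> real k * (pp * s ^ (block_size j - 1))" using 1 by linarith
  also have "s ^ (block_size j - 1) = s ^ (block_size j - 2) * s"
  proof -
    have "block_size j - 1 = Suc (block_size j - 2)" using j(2) by simp
    then show ?thesis by (simp add: mult.commute)
  qed
  \<comment> \<open>The common factor is positive and cancels, leaving the product \<open>c\<close>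
    against a single power of \<open>s\<close>.\<close>
  finally have "(pp * s ^ (block_size j - 2)) * c \<le> (pp * s ^ (block_size j - 2)) * (real k * s)"
    unfolding \<mu>G by (simp add: algebra_simps)
  moreover have "pp * s ^ (block_size j - 2) > 0" using pp s_pos by simp
  ultimately have "c \<le> real k * s" by (metis mult_le_cancel_left_pos)
  then show ?thesis by (simp add: c_def s_def A_def)
qed

text \<open>Probabilities of disjoint events are summable and hence tend to zero.\<close>

lemma disjoint_events_small:
  fixes A :: "nat \<Rightarrow> real set"
  assumes "\<And>n. A n \<in> sets borel" "\<And>n n'. n < n' \<Longrightarrow> A n \<inter> A n' = {}" "c > 0"
    and le: "\<And>n. c \<le> real k * measure U (A n)"
  shows False
proof -
  have "disjoint_family A"
    unfolding disjoint_family_on_def using assms(2) by (metis Int_commute linorder_neq_iff)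
  then have "(\<lambda>n. measure U (A n)) sums measure U (\<Union>n. A n)"
    using assms(1) by (intro finite_measure_UNION) (auto simp: sets_U)
  then have "(\<lambda>n. measure U (A n)) \<longlonglongrightarrow> 0"
    by (intro summable_LIMSEQ_zero sums_summable)
  then have "(\<lambda>n. real k * measure U (A n)) \<longlonglongrightarrow> real k * 0"
    by (rule tendsto_mult_left)
  then have "c \<le> real k * 0" by (rule LIMSEQ_le_const) (use le in blast)
  then show False using \<open>c > 0\<close> by simp
qed

lemma split_prob_pos:
  assumes g: "mono g" and "\<alpha> < \<beta>" "measure U {x. g x = \<alpha>} > 0" "measure U {x. g x = \<beta>} > 0"
  shows "split_prob g \<alpha> \<beta> > 0"
proof -
  have lev: "{x. g x = v} \<in> sets borel" for v by (rule level_set_borel[OF _ g]) simp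
  have "0 < pair_prob (\<lambda>x y. x \<in> {x. g x = \<alpha>} \<and> y \<in> {x. g x = \<beta>})"
    using assms by (simp only: pair_prob_Times[OF lev lev]) simp
  also have "\<dots> \<le> split_prob g \<alpha> \<beta>"
    unfolding split_prob_def by (rule pair_prob_mono[OF _ pred_pair[OF g]]) (use assms in auto)
  finally show ?thesis .
qed

text \<open>For an increasing sequence of levels the last block takes the stretch, because the first
  members of the sequence then leave room below for the other blocks; for a decreasing sequence the
  situation is mirrored. The product in \<open>merge_bound\<close> is thus the same for all
  stretches.\<close>

lemma finite_positive_levels:
  assumes g: "mono g" and opt: "\<And>h. mono h \<Longrightarrow> measure (\<Omega> {1..m}) (E h) \<le> measure (\<Omega> {1..m}) (E g)"
    and k: "k \<ge> 1" and L1: "block_size 1 \<ge> 2" and Lk: "block_size k \<ge> 2"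
    and adj: "\<And>i. i \<in> {1..<k} \<Longrightarrow> max (block_size 1) (block_size k) + 1 \<le> block_size i + block_size (i + 1)"
  shows "finite {v. measure U {x. g x = v} > 0}" (is "finite ?V")
proof (rule ccontr)
  assume "infinite ?V"
  then obtain w :: "nat \<Rightarrow> real" where w: "inj w" "range w \<subseteq> ?V"
    using infinite_countable_subset by blast
  obtain f where f: "strict_mono f" "monoseq (\<lambda>n. w (f n))" using seq_monosub[of w] by blast
  define v where "v n = w (f n)" for n
  have pos: "measure U {x. g x = v n} > 0" for n using w(2) by (auto simp: v_def)
  have inj: "inj v" using inj_compose[OF w(1) strict_mono_imp_inj_on[OF f(1)]] by (simp add: v_def[abs_def] comp_def)
  have borel: "{x. \<alpha> \<le> g x \<and> g x \<le> \<beta>} \<in> sets borel" for \<alpha> \<beta> by (rule level_set_borel[OF _ g]) measurable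
  consider "incseq v" | "decseq v" using f(2) unfolding monoseq_iff v_def[abs_def] by blast
  then show False
  proof cases
    case 1
    have less: "v n < v n'" if "n < n'" for n n'
      using incseqD[OF 1, of n n'] injD[OF inj, of n n'] that by fastforce
    show False
    proof (rule disjoint_events_small)
      fix n
      \<comment> \<open>The offset \<open>k\<close> keeps the stretch above the levels
        \<open>v 1\<close>, ..., \<open>v (k - 1)\<close> of the other blocks; the step 2 makes the
        stretches for different \<open>n\<close> disjoint.\<close>
      show "(\<Prod>t\<in>{t \<in> {1..m}. b t \<noteq> k}. measure U {x. g x = v (b t)}) \<le>
          real k * measure U {x. v (k + 2 * n) \<le> g x \<and> g x \<le> v (k + 2 * n + 1)}"
      proof (rule merge_bound[OF g opt])
        show "split_prob g (v (k + 2 * n)) (v (k + 2 * n + 1)) > 0"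
          by (rule split_prob_pos[OF g less pos pos]) simp
        show "block_size k + 1 \<le> block_size i + block_size (i + 1)" if "i \<in> {1..<k}" for i using adj[OF that] by simp
      qed (use k Lk less in \<open>auto intro: less_imp_le\<close>)
    next
      fix n n' :: nat assume "n < n'"
      then have "v (k + 2 * n + 1) < v (k + 2 * n')" by (intro less) simp
      then show "{x. v (k + 2 * n) \<le> g x \<and> g x \<le> v (k + 2 * n + 1)} \<inter>
          {x. v (k + 2 * n') \<le> g x \<and> g x \<le> v (k + 2 * n' + 1)} = {}" by auto
    qed (auto intro!: prod_pos pos borel)
  next
    case 2
    have less: "v n' < v n" if "n < n'" for n n'
      using decseqD[OF 2, of n n'] injD[OF inj, of n n'] that by fastforce
    show False
    proof (rule disjoint_events_small)
      fix n
      \<comment> \<open>The index \<open>k - b t\<close> reverses the decreasing sequence, so that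
        later blocks get higher levels.\<close>
      show "(\<Prod>t\<in>{t \<in> {1..m}. b t \<noteq> 1}. measure U {x. g x = v (k - b t)}) \<le>
          real k * measure U {x. v (k + 2 * n + 1) \<le> g x \<and> g x \<le> v (k + 2 * n)}"
      proof (rule merge_bound[OF g opt, where u = "\<lambda>i. v (k - i)"])
        show "split_prob g (v (k + 2 * n + 1)) (v (k + 2 * n)) > 0"
          by (rule split_prob_pos[OF g less pos pos]) simp
        show "block_size 1 + 1 \<le> block_size i + block_size (i + 1)" if "i \<in> {1..<k}" for i using adj[OF that] by simp
        show "v (k + 2 * n) < v (k - i)" if "i \<in> {1..k}" "1 < i" for i using that by (intro less) auto
        show "v (k - i) < v (k - i')" if "i \<in> {1..k} - {1}" "i' \<in> {1..k} - {1}" "i < i'" for i i'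
          using that by (intro less) auto
      qed (use k L1 less in \<open>auto intro: less_imp_le\<close>)
    next
      fix n n' :: nat assume "n < n'"
      then have "v (k + 2 * n') < v (k + 2 * n + 1)" by (intro less) simp
      then show "{x. v (k + 2 * n + 1) \<le> g x \<and> g x \<le> v (k + 2 * n)} \<inter>
          {x. v (k + 2 * n' + 1) \<le> g x \<and> g x \<le> v (k + 2 * n')} = {}" by auto
    qed (auto intro!: prod_pos pos borel)
  qed
qed

section \<open>Stretches of levels of measure zero\<close>

definition bisect :: "real \<Rightarrow> real \<Rightarrow> real \<Rightarrow> real \<Rightarrow> real" where
  "bisect c e d t = (if c < t \<and> t \<le> e then e else if e < t \<and> t < d then (e + d) / 2 else t)"

text \<open>Both new levels lie strictly between \<open>c\<close> and \<open>d\<close> and so stay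
  apart from all levels outside the stretch; the midpoint is one convenient value between
  \<open>e\<close> and \<open>d\<close>.\<close>

lemma mono_bisect: "c < e \<Longrightarrow> e < d \<Longrightarrow> mono (bisect c e d)"
  by (rule monoI) (auto simp: bisect_def field_simps)

lemma bisect_eq:
  "c < e \<Longrightarrow> e < d \<Longrightarrow> s < t \<Longrightarrow> bisect c e d t \<le> bisect c e d s \<Longrightarrow> c < s \<and> t < d"
  by (auto simp: bisect_def field_simps split: if_splits)

text \<open>
  A stretch \<open>(c, d)\<close> of levels of measure zero serves blocks of size one only, hence at most one
  block at a time. Replacing it by two layers loses nothing, and lets two adjacent blocks, one of
  them of size at least two, use the stretch.
\<close>
lemma no_null_stretch:
  assumes g: "mono g" and opt: "\<And>h. mono h \<Longrightarrow> measure (\<Omega> {1..m}) (E h) \<le> measure (\<Omega> {1..m}) (E g)"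
    and k: "k \<ge> 2" and adj: "\<And>i. i \<in> {1..<k} \<Longrightarrow> block_size i \<ge> 2 \<or> block_size (i + 1) \<ge> 2"
    and pos: "measure (\<Omega> {1..m}) (E g) > 0"
    and ced: "c < e" "e < d" and null: "\<And>v. v \<in> {c<..<d} \<Longrightarrow> measure U {x. g x = v} = 0"
    and pos1: "measure U {x. c < g x \<and> g x \<le> e} > 0" and pos2: "measure U {x. e < g x \<and> g x < d} > 0"
  shows False
proof -
  interpret O: prob_space "\<Omega> {1..m}" by (rule prob_space_\<Omega>)
  let ?\<mu> = "measure (\<Omega> {1..m})"
  let ?h = "\<lambda>x. bisect c e d (g x)"
  have h: "mono ?h" using g mono_bisect[OF ced] by (auto simp: mono_def)
  note sets = E_measurable[OF g] E_measurable[OF h]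
  \<comment> \<open>An event of probability one. On it, a block of size at least two cannot occupy a
    level of the stretch.\<close>
  define R where "R = {x \<in> space (\<Omega> {1..m}). \<forall>p\<in>{1..m}. \<forall>q\<in>{1..m}. p \<noteq> q \<longrightarrow>
    \<not> (g (x p) = g (x q) \<and> g (x p) \<in> {c<..<d})}"
  have R_sets: "R \<in> sets (\<Omega> {1..m})"
    unfolding R_def
  proof (intro sets.sets_Collect_finite_All finite_atLeastAtMost)
    fix p q assume pq: "p \<in> {1..m}" "q \<in> {1..m}"
    note gx = mono_component_measurable[OF g pq(1)] mono_component_measurable[OF g pq(2)]
    have "{x \<in> space (\<Omega> {1..m}). g (x p) = g (x q) \<and> c < g (x p) \<and> g (x p) < d} \<in> sets (\<Omega> {1..m})"
      by (intro sets.sets_Collect_conj borel_measurable_eq borel_measurable_less gx borel_measurable_const)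
    then show "{x \<in> space (\<Omega> {1..m}). p \<noteq> q \<longrightarrow> \<not> (g (x p) = g (x q) \<and> g (x p) \<in> {c<..<d})} \<in> sets (\<Omega> {1..m})"
      unfolding greaterThanLessThan_iff by (intro sets.sets_Collect_imp sets.sets_Collect_neg sets.sets_Collect_const)
  qed
  have "AE x in \<Omega> {1..m}. \<forall>p\<in>{1..m}. \<forall>q\<in>{1..m}. p \<noteq> q \<longrightarrow>
    \<not> (g (x p) = g (x q) \<and> g (x p) \<in> {c<..<d})"
  proof (intro AE_finite_allI finite_atLeastAtMost)
    fix p q assume pq: "p \<in> {1..m}" "q \<in> {1..m}"
    show "AE x in \<Omega> {1..m}. p \<noteq> q \<longrightarrow> \<not> (g (x p) = g (x q) \<and> g (x p) \<in> {c<..<d})"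
    proof (cases "p = q")
      case False
      have "AE x in \<Omega> {1..m}. \<not> (g (x p) = g (x q) \<and> g (x p) \<in> {c<..<d})"
        by (rule AE_pair_level[OF borel_measurable_mono[OF g] _ null pq False]) simp_all
      then show ?thesis by eventually_elim blast
    qed simp
  qed
  then have AE_R: "AE x in \<Omega> {1..m}. x \<in> R"
    using AE_space by eventually_elim (simp add: R_def)
  have R_full: "?\<mu> (X \<inter> R) = ?\<mu> X" if "X \<in> sets (\<Omega> {1..m})" for X
    using AE_R that R_sets by (intro O.finite_measure_eq_AE) auto
  have same: False if "x \<in> R" "p \<in> {1..m}" "q \<in> {1..m}" "p \<noteq> q" "g (x p) = g (x q)" "c < g (x p)" "g (x p) < d"
    for x p q using that unfolding R_def by auto
  have two: "\<exists>p q. p \<in> {1..m} \<and> q \<in> {1..m} \<and> p \<noteq> q \<and> b p = b q \<and> (b p = i \<or> b p = i + 1)" if i: "i \<in> {1..<k}" for i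
  proof -
    obtain i' where i': "i' = i \<or> i' = i + 1" "block_size i' \<ge> 2" using adj[OF i] by blast
    then have "\<not> card {t \<in> {1..m}. b t = i'} \<le> 1" by (simp add: block_size_def)
    then obtain p q where "p \<in> {t \<in> {1..m}. b t = i'}" "q \<in> {t \<in> {1..m}. b t = i'}" "p \<noteq> q"
      using card_le_Suc0_iff_eq[of "{t \<in> {1..m}. b t = i'}"] by auto
    then show ?thesis using i'(1) by (intro exI[of _ p] exI[of _ q]) auto
  qed
  have Eg_less: "g (x p) < g (x q) \<longleftrightarrow> b p < b q" if "x \<in> E g" "p \<in> {1..m}" "q \<in> {1..m}" for x p q
    using that by (simp add: E_def)
  have Eg_eq: "g (x p) = g (x q)" if "x \<in> E g" "p \<in> {1..m}" "q \<in> {1..m}" "b p = b q" for x p q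
    using Eg_less[OF that(1-3)] Eg_less[OF that(1,3,2)] that(4) by linarith
  have one_block: "b p = b q" if x: "x \<in> E g" "x \<in> R" and pq: "p \<in> {1..m}" "q \<in> {1..m}"
    and mid: "c < g (x p)" "g (x p) < d" "c < g (x q)" "g (x q) < d" for x p q
  proof -
    \<comment> \<open>Block \<open>b p\<close> and its successor would both be trapped in the
      stretch, and one of them has two points, which share a level under \<open>E g\<close>.\<close>
    have False if pq: "p \<in> {1..m}" "q \<in> {1..m}" and less: "b p < b q"
      and mid: "c < g (x p)" "g (x q) < d" for p q
    proof -
      have "b p \<in> {1..<k}" using less b_range[OF pq(1)] b_range[OF pq(2)] by auto
      then obtain p' q' where p': "p' \<in> {1..m}" "q' \<in> {1..m}" "p' \<noteq> q'" "b p' = b q'"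
        and bp: "b p' = b p \<or> b p' = b p + 1" using two by blast
      have "\<not> g (x p') < g (x p)" "\<not> g (x q) < g (x p')"
        using Eg_less[OF x(1) p'(1) pq(1)] Eg_less[OF x(1) pq(2) p'(1)] bp less by auto
      then have "c < g (x p')" "g (x p') < d" using mid by linarith+
      then show False using same[OF x(2) p'(1-3)] Eg_eq[OF x(1) p'(1,2,4)] by blast
    qed
    then show ?thesis using pq mid by (metis linorder_neq_iff)
  qed
  have sub: "E g \<inter> R \<subseteq> E ?h"
  proof
    fix x assume x: "x \<in> E g \<inter> R"
    show "x \<in> E ?h"
      unfolding E_def mem_Collect_eq
    proof (intro conjI ballI)
      show "x \<in> space (\<Omega> {1..m})" using x by (simp add: E_def)
      fix p q assume pq: "p \<in> {1..m}" "q \<in> {1..m}"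
      show "?h (x p) < ?h (x q) \<longleftrightarrow> b p < b q"
      proof
        assume "?h (x p) < ?h (x q)"
        then have "g (x p) < g (x q)"
          using monoD[OF mono_bisect[OF ced], of "g (x q)" "g (x p)"] by linarith
        then show "b p < b q" using Eg_less x pq by blast
      next
        assume less: "b p < b q"
        then have "g (x p) < g (x q)" using Eg_less x pq by blast
        show "?h (x p) < ?h (x q)"
        proof (rule ccontr)
          assume "\<not> ?h (x p) < ?h (x q)"
          then have "c < g (x p) \<and> g (x q) < d"
            using bisect_eq[OF ced \<open>g (x p) < g (x q)\<close>] by simp
          then have "b p = b q"
            using one_block[of x p q] x pq \<open>g (x p) < g (x q)\<close> by auto
          then show False using less by simp
        qed
      qed
    qed
  qed
  \<comment> \<open>The blocks before \<open>i\<close> lie at or below \<open>c\<close> and those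
    after \<open>i + 1\<close> at or above \<open>d\<close>, so that blocks \<open>i\<close> and
    \<open>i + 1\<close> can be moved into the stretch.\<close>
  define N where "N i = {x \<in> E g. \<forall>t\<in>{1..m}. (b t < i \<longrightarrow> g (x t) \<le> c) \<and> (i + 1 < b t \<longrightarrow> d \<le> g (x t))}" for i
  have N_sets: "N i \<in> sets (\<Omega> {1..m})" for i
  proof -
    have "{x \<in> space (\<Omega> {1..m}). \<forall>t\<in>{1..m}. (b t < i \<longrightarrow> g (x t) \<le> c) \<and> (i + 1 < b t \<longrightarrow> d \<le> g (x t))} \<in> sets (\<Omega> {1..m})"
    proof (intro sets.sets_Collect_finite_All finite_atLeastAtMost)
      fix t assume t: "t \<in> {1..m}"
      show "{x \<in> space (\<Omega> {1..m}). (b t < i \<longrightarrow> g (x t) \<le> c) \<and> (i + 1 < b t \<longrightarrow> d \<le> g (x t))} \<in> sets (\<Omega> {1..m})"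
        by (intro sets.sets_Collect_conj sets.sets_Collect_imp sets.sets_Collect_const borel_measurable_le
            mono_component_measurable[OF g t] borel_measurable_const)
    qed
    then have "E g \<inter> {x \<in> space (\<Omega> {1..m}). \<forall>t\<in>{1..m}. (b t < i \<longrightarrow> g (x t) \<le> c) \<and> (i + 1 < b t \<longrightarrow> d \<le> g (x t))} \<in> sets (\<Omega> {1..m})"
      by (rule sets.Int[OF sets(1)])
    also have "E g \<inter> {x \<in> space (\<Omega> {1..m}). \<forall>t\<in>{1..m}. (b t < i \<longrightarrow> g (x t) \<le> c) \<and> (i + 1 < b t \<longrightarrow> d \<le> g (x t))} = N i"
      unfolding N_def E_def by blast
    finally show ?thesis .
  qed
  have cover: "E g \<inter> R \<subseteq> (\<Union>i\<in>{1..<k}. N i)"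
  proof
    fix x assume x: "x \<in> E g \<inter> R"
    \<comment> \<open>The last block at or below \<open>c\<close>, or 0 if there is none. By
      \<open>one_block\<close>, only block \<open>q + 1\<close> can meet the stretch.\<close>
    define q where "q = Max (insert 0 (b ` {t \<in> {1..m}. g (x t) \<le> c}))"
    \<comment> \<open>Clamping to \<open>{1..<k}\<close> takes care of \<open>q = 0\<close> and
      \<open>q = k\<close>.\<close>
    define i where "i = max 1 (min q (k - 1))"
    have fin: "finite (insert 0 (b ` {t \<in> {1..m}. g (x t) \<le> c}))" by simp
    have q_ge: "b t \<le> q" if "t \<in> {1..m}" "g (x t) \<le> c" for t
      unfolding q_def using that by (intro Max_ge[OF fin]) auto
    have low: "g (x t) \<le> c" if t: "t \<in> {1..m}" "b t \<le> q" for t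
    proof -
      have "q \<in> insert 0 (b ` {t \<in> {1..m}. g (x t) \<le> c})" unfolding q_def by (rule Max_in[OF fin]) simp
      moreover have "q \<noteq> 0" using t b_range[OF t(1)] by auto
      ultimately obtain t' where "t' \<in> {1..m}" "g (x t') \<le> c" "b t' = q" by auto
      then show ?thesis using Eg_less[of x t' t] x t by fastforce
    qed
    have i: "i \<in> {1..<k}" using k by (auto simp: i_def)
    have "x \<in> N i"
      unfolding N_def mem_Collect_eq
    proof (intro conjI ballI impI)
      fix t assume t: "t \<in> {1..m}"
      show "g (x t) \<le> c" if "b t < i"
        by (rule low[OF t]) (use that b_range[OF t] in \<open>auto simp: i_def\<close>)
      show "d \<le> g (x t)" if bt: "i + 1 < b t"
      proof (rule ccontr)
        assume *: "\<not> d \<le> g (x t)"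
        have qi: "q < i + 1" "i + 1 \<in> {1..k}" using bt b_range[OF t] by (auto simp: i_def)
        then obtain t' where t': "t' \<in> {1..m}" "b t' = i + 1" using b_onto by blast
        have "c < g (x t')" using q_ge[OF t'(1)] t'(2) qi(1) by (cases "g (x t') \<le> c") auto
        moreover have "g (x t') < g (x t)" using Eg_less[of x t' t] x t t' bt by simp
        ultimately have "b t' = b t" using one_block[of x t' t] x t t'(1) * by auto
        then show False using t'(2) bt by simp
      qed
    qed (use x in simp)
    then show "x \<in> (\<Union>i\<in>{1..<k}. N i)" using i by blast
  qed
  have "\<exists>i\<in>{1..<k}. ?\<mu> (N i) > 0"
  proof (rule ccontr)
    assume "\<not> ?thesis"
    then have zero: "?\<mu> (N i) = 0" if "i \<in> {1..<k}" for i
      using that by (meson measure_nonneg order.antisym not_le)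
    have "?\<mu> (E g) = ?\<mu> (E g \<inter> R)" using R_full[OF sets(1)] by simp
    also have "\<dots> \<le> ?\<mu> (\<Union>i\<in>{1..<k}. N i)"
      using N_sets by (intro O.finite_measure_mono cover) auto
    also have "\<dots> \<le> (\<Sum>i\<in>{1..<k}. ?\<mu> (N i))"
      using N_sets by (intro O.finite_measure_subadditive_finite) auto
    also have "\<dots> = 0" using zero by simp
    finally show False using pos by simp
  qed
  then obtain i where i: "i \<in> {1..<k}" and Ni: "?\<mu> (N i) > 0" by blast
  define B where "B t = (if b t = i then {x. c < g x \<and> g x \<le> e} else {x. e < g x \<and> g x < d})" for t
  define J where "J = {t \<in> {1..m}. b t = i \<or> b t = i + 1}"
  \<comment> \<open>The gained configurations. Redrawing block \<open>i\<close> from the lower part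
    of the stretch and block \<open>i + 1\<close> from the upper part turns samples in
    \<open>N i\<close> into samples in \<open>G\<close>.\<close>
  define G where "G = {x \<in> E ?h. \<forall>t\<in>J. x t \<in> {x. c < g x \<and> g x < d}}"
  let ?X = "{x \<in> space (\<Omega> {1..m}). \<forall>t\<in>J. x t \<in> B t}"
  have borel: "{x. c < g x \<and> g x \<le> e} \<in> sets borel" "{x. e < g x \<and> g x < d} \<in> sets borel"
    "{x. c < g x \<and> g x < d} \<in> sets borel" by (rule level_set_borel[OF _ g]; measurable)+
  have J: "finite J" "J \<subseteq> {1..m}" by (auto simp: J_def)
  have B: "B t \<in> sets borel" for t using borel by (simp add: B_def)
  have X_sets: "?X \<in> sets (\<Omega> {1..m})" by (rule box_measurable[OF B J(2)])
  have "?\<mu> ?X = (\<Prod>t\<in>J. measure U (B t))" by (rule measure_box[OF J B])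
  also have "\<dots> > 0" using pos1 pos2 by (intro prod_pos) (simp add: B_def)
  finally have X: "?\<mu> ?X > 0" .
  have "{x \<in> space (\<Omega> {1..m}). \<forall>t\<in>J. x t \<in> {x. c < g x \<and> g x < d}} \<in> sets (\<Omega> {1..m})"
    by (rule box_measurable[OF borel(3) J(2)])
  then have "E ?h \<inter> {x \<in> space (\<Omega> {1..m}). \<forall>t\<in>J. x t \<in> {x. c < g x \<and> g x < d}} \<in> sets (\<Omega> {1..m})"
    by (rule sets.Int[OF sets(2)])
  also have "E ?h \<inter> {x \<in> space (\<Omega> {1..m}). \<forall>t\<in>J. x t \<in> {x. c < g x \<and> g x < d}} = G"
    unfolding G_def E_def by blast
  finally have G_sets: "G \<in> sets (\<Omega> {1..m})" .
  have "?\<mu> (N i) * ?\<mu> ?X \<le> ?\<mu> G"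
  proof (rule measure_resample_ge[OF finite_atLeastAtMost N_sets X_sets G_sets])
    fix x y assume x: "x \<in> N i" and y: "y \<in> ?X"
    let ?z = "\<lambda>t\<in>{1..m}. if t \<in> J then y t else x t"
    define w where "w t = (if b t = i then e else if b t = i + 1 then (e + d) / 2 else g (x t))" for t
    have xE: "x \<in> E g" using x by (simp add: N_def)
    have hz: "?h (?z t) = w t" if t: "t \<in> {1..m}" for t
    proof (cases "t \<in> J")
      case True
      then have "y t \<in> B t" using y by blast
      then show ?thesis using True t by (auto simp: J_def B_def w_def bisect_def)
    next
      case False
      then have "b t < i \<or> i + 1 < b t" using t by (auto simp: J_def)
      then have "g (x t) \<le> c \<or> d \<le> g (x t)" using x t unfolding N_def by blast
      then show ?thesis using False t ced by (auto simp: J_def w_def bisect_def)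
    qed
    have w_cases: "w t \<le> c \<and> b t < i \<or> w t = e \<and> b t = i \<or> w t = (e + d) / 2 \<and> b t = i + 1 \<or> d \<le> w t \<and> i + 1 < b t"
      if t: "t \<in> {1..m}" for t
      using x t unfolding N_def w_def by (cases "b t < i"; cases "i + 1 < b t"; force)
    have w: "w t < w t' \<longleftrightarrow> b t < b t'" if t: "t \<in> {1..m}" "t' \<in> {1..m}" for t t'
    proof (cases "t \<in> J \<or> t' \<in> J")
      case True
      have "e < (e + d) / 2" "(e + d) / 2 < d" using ced by auto
      then show ?thesis
        using True w_cases[OF t(1)] w_cases[OF t(2)] ced(1) t by (auto simp: J_def)
    next
      case False
      then show ?thesis using Eg_less[OF xE t] t by (simp add: J_def w_def)
    qed
    show "?z \<in> G"
      unfolding G_def mem_Collect_eq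
    proof (intro conjI ballI)
      show "?z \<in> E ?h"
        unfolding E_def mem_Collect_eq
      proof (intro conjI ballI)
        show "?z \<in> space (\<Omega> {1..m})" by (simp add: space_PiM)
        show "?h (?z t) < ?h (?z t') \<longleftrightarrow> b t < b t'" if "t \<in> {1..m}" "t' \<in> {1..m}" for t t'
          by (simp only: hz[OF that(1)] hz[OF that(2)] w[OF that])
      qed
      fix t assume t: "t \<in> J"
      then have "y t \<in> B t" using y by blast
      then show "c < g (?z t)" "g (?z t) < d" using t J(2) ced by (auto simp: B_def split: if_splits)
    qed
  qed
  then have "0 < ?\<mu> (G \<inter> R)"
    using R_full[OF G_sets] mult_pos_pos[OF Ni X] by linarith
  \<comment> \<open>Under \<open>E g\<close>, a block with two points among \<open>i\<close> and
    \<open>i + 1\<close> would occupy a single level of the stretch, which \<open>R\<close>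
    excludes.\<close>
  moreover have "(E g \<inter> R) \<inter> (G \<inter> R) = {}"
  proof (rule equals0I)
    fix x assume x: "x \<in> (E g \<inter> R) \<inter> (G \<inter> R)"
    obtain p q where pq: "p \<in> {1..m}" "q \<in> {1..m}" "p \<noteq> q" "b p = b q" and "b p = i \<or> b p = i + 1"
      using two[OF i] by blast
    then have "p \<in> J" by (simp add: J_def)
    then have "c < g (x p)" "g (x p) < d" using x unfolding G_def by blast+
    then show False using same[of x p q] Eg_eq[of x p q] pq x by blast
  qed
  then have "?\<mu> (E g \<inter> R) + ?\<mu> (G \<inter> R) = ?\<mu> ((E g \<inter> R) \<union> (G \<inter> R))"
    using sets R_sets G_sets by (intro O.finite_measure_Union[symmetric]) auto
  moreover have "?\<mu> ((E g \<inter> R) \<union> (G \<inter> R)) \<le> ?\<mu> (E ?h)"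
    using sub sets by (intro O.finite_measure_mono) (auto simp: G_def)
  ultimately show False
    using opt[OF h] R_full[OF sets(1)] by linarith
qed

end

section \<open>Layered permutons\<close>

text \<open>A point outside the support has a basic open neighbourhood of measure zero, and a
  countable basis offers only countably many of these.\<close>

lemma AE_msupport:
  fixes M :: "'a::second_countable_topology measure"
  assumes sets: "\<And>V. open V \<Longrightarrow> V \<inter> space M \<in> sets M"
  shows "AE z in M. z \<in> msupport M"
proof -
  obtain B :: "'a set set" where B: "countable B" "topological_basis B"
    using ex_countable_basis by blast
  define C where "C = {V \<in> B. emeasure M (V \<inter> space M) = 0}"
  have "AE z in M. \<forall>V\<in>C. z \<notin> V \<inter> space M"
  proof (subst AE_ball_countable)
    show "countable C" using B(1) unfolding C_def by simp
    show "\<forall>V\<in>C. AE z in M. z \<notin> V \<inter> space M"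
    proof
      fix V assume "V \<in> C"
      then have "V \<inter> space M \<in> null_sets M"
        using sets[OF topological_basis_open[OF B(2)]] by (intro null_setsI) (simp_all add: C_def)
      then show "AE z in M. z \<notin> V \<inter> space M" by (rule AE_not_in)
    qed
  qed
  then show ?thesis using AE_space
  proof eventually_elim
    case (elim z)
    show ?case
      unfolding msupport_def mem_Collect_eq
    proof (intro conjI allI impI elim(2))
      fix W assume W: "open W" "z \<in> W"
      then obtain V where V: "V \<in> B" "z \<in> V" "V \<subseteq> W" by (rule topological_basisE[OF B(2)])
      then have "emeasure M (V \<inter> space M) \<noteq> 0" using elim by (auto simp: C_def)
      moreover have "emeasure M (V \<inter> space M) \<le> emeasure M (W \<inter> space M)"
        using V(3) sets[OF W(1)] by (intro emeasure_mono) auto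
      ultimately show "0 < emeasure M (W \<inter> space M)" by (metis not_gr_zero le_zero_eq)
    qed
  qed
qed

text \<open>Partial sums of the sizes mark the last positions of the layers, so the layer of
  \<open>i\<close> is the first one that does not end before \<open>i\<close>.\<close>

lemma layered_perm_blocks:
  assumes "layered_perm k l \<sigma>"
  defines "m \<equiv> \<Sum>i=1..k. l i"
  obtains b where "\<And>i. i \<in> {1..m} \<Longrightarrow> b i \<in> {1..k}"
    "\<And>i j. i \<in> {1..m} \<Longrightarrow> j \<in> {1..m} \<Longrightarrow> i \<le> j \<Longrightarrow> b i \<le> b j"
    "\<And>j. j \<in> {1..k} \<Longrightarrow> card {t \<in> {1..m}. b t = j} = l j"
    "\<And>i j. i \<in> {1..m} \<Longrightarrow> j \<in> {1..m} \<Longrightarrow> \<sigma> i < \<sigma> j \<longleftrightarrow> b i < b j \<or> b i = b j \<and> j < i"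
proof -
  define S where "S j = (\<Sum>i=1..j. l i)" for j
  have S_mono: "S i \<le> S j" if "i \<le> j" for i j unfolding S_def using that by (intro sum_mono2) auto
  have S0: "S 0 = 0" by (simp add: S_def)
  have S_Suc: "S (Suc j) = S j + l (Suc j)" for j by (simp add: S_def)
  have layer: "layer_interval l j = {S (j - 1) <.. S j}" if "j \<ge> 1" for j
  proof -
    have "{1..<j} = {1..j - 1}" using that by auto
    then show ?thesis by (simp add: layer_interval_def S_def)
  qed
  have mS: "m = S k" by (simp add: m_def S_def)
  define b where "b i = (LEAST j. i \<le> S j)" for i
  have b: "i \<le> S (b i)" "b i \<in> {1..k}" "i \<in> layer_interval l (b i)" if "i \<in> {1..m}" for i
  proof -
    have iS: "i \<le> S k" using that by (simp add: mS)
    show 1: "i \<le> S (b i)" unfolding b_def using iS by (rule LeastI)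
    have "b i \<noteq> 0"
    proof
      assume "b i = 0"
      then show False using 1 S0 that by simp
    qed
    moreover have "b i \<le> k" unfolding b_def using iS by (rule Least_le)
    ultimately show 2: "b i \<in> {1..k}" by auto
    have "\<not> i \<le> S (b i - 1)"
      unfolding b_def by (rule not_less_Least) (use \<open>b i \<noteq> 0\<close> in \<open>simp add: b_def\<close>)
    then show "i \<in> layer_interval l (b i)" using 1 2 layer by auto
  qed
  have b_eq: "b t = j" if "j \<in> {1..k}" "S (j - 1) < t" "t \<le> S j" for t j
    unfolding b_def
  proof (rule Least_equality)
    show "j \<le> j'" if "t \<le> S j'" for j'
    proof (rule ccontr)
      assume "\<not> j \<le> j'"
      then have "S j' \<le> S (j - 1)" by (intro S_mono) simp
      then show False using that \<open>S (j - 1) < t\<close> by simp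
    qed
  qed (rule that(3))
  show thesis
  proof (rule that)
    show "b i \<in> {1..k}" if "i \<in> {1..m}" for i by (rule b(2)[OF that])
    show "b i \<le> b j" if "i \<in> {1..m}" "j \<in> {1..m}" "i \<le> j" for i j
    proof -
      have "i \<le> S (b j)" using b(1)[OF that(2)] that(3) by simp
      then show ?thesis unfolding b_def[of i] by (rule Least_le)
    qed
    show "card {t \<in> {1..m}. b t = j} = l j" if j: "j \<in> {1..k}" for j
    proof -
      have "{t \<in> {1..m}. b t = j} = {S (j - 1) <.. S j}"
      proof (intro set_eqI iffI)
        fix t assume "t \<in> {t \<in> {1..m}. b t = j}"
        then show "t \<in> {S (j - 1) <.. S j}" using b(3)[of t] layer[of j] j by auto
      next
        fix t assume t: "t \<in> {S (j - 1) <.. S j}"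
        moreover have "S j \<le> m" unfolding mS using j by (intro S_mono) simp
        ultimately show "t \<in> {t \<in> {1..m}. b t = j}" using b_eq[OF j, of t] by auto
      qed
      moreover have "S j = S (j - 1) + l j" using S_Suc[of "j - 1"] j by simp
      ultimately show ?thesis by simp
    qed
    fix i j assume ij: "i \<in> {1..m}" "j \<in> {1..m}"
    have less: "\<sigma> i < \<sigma> j" if "i \<in> {1..m}" "j \<in> {1..m}" "b i < b j" for i j
      using assms(1) b(2,3)[OF that(1)] b(2,3)[OF that(2)] that(3) unfolding layered_perm_def by blast
    have greater: "\<sigma> j < \<sigma> i" if "i \<in> {1..m}" "j \<in> {1..m}" "b i = b j" "i < j" for i j
      using assms(1) b(2,3)[OF that(1)] b(2,3)[OF that(2)] that(3,4) unfolding layered_perm_def by metis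
    show "\<sigma> i < \<sigma> j \<longleftrightarrow> b i < b j \<or> b i = b j \<and> j < i"
      using less[OF ij] less[OF ij(2,1)] greater[OF ij] greater[OF ij(2,1)]
      by (metis less_asym less_irrefl linorder_neq_iff)
  qed
qed

section \<open>The levels of a layered permuton\<close>

locale layered_marginal =
  fixes P :: "(real \<times> real) measure" and J :: "real set set"
  assumes permuton: "permuton P" and J: "layer_collection P J"
begin

text \<open>The inequalities are strict because an end point may be shared by two layers; the points
  over layer ends form a null set.\<close>

definition inside :: "real \<Rightarrow> real \<Rightarrow> real \<Rightarrow> bool" where
  "inside x a c \<longleftrightarrow> {a..c} \<in> J \<and> a < x \<and> x < c"

definition g :: "real \<Rightarrow> real" where
  "g x = (if \<exists>a c. inside x a c then THE a. \<exists>c. inside x a c else x)"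

text \<open>Internal disjointness keeps layers of length zero out of the interior of others, so
  \<open>a' = c'\<close> is covered too.\<close>

lemma layer_unique:
  assumes "inside x a c" "{a'..c'} \<in> J" "a' \<le> x" "x \<le> c'"
  shows "a' = a" "c' = c"
proof -
  have "x \<in> interior {a..c} \<inter> {a'..c'}" using assms by (auto simp: inside_def)
  then have "{a..c} = {a'..c'}"
    using J assms(1,2) unfolding layer_collection_def inside_def by blast
  then show "a' = a" "c' = c" using assms by (auto simp: Icc_eq_Icc inside_def)
qed

lemma g_inside: "inside x a c \<Longrightarrow> g x = a"
proof -
  assume x: "inside x a c"
  then have "(THE a. \<exists>c. inside x a c) = a"
    using layer_unique(1)[OF x] by (intro the_equality) (auto simp: inside_def)
  then show ?thesis using x by (auto simp: g_def)
qed

lemma g_outside: "(\<And>a c. \<not> inside x a c) \<Longrightarrow> g x = x"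
  by (simp add: g_def)

lemma mono_g: "mono g"
proof (rule monoI)
  fix x y :: real assume xy: "x \<le> y"
  consider (1) a c a' c' where "inside x a c" "inside y a' c'" | (2) a c where "inside x a c" "\<And>a c. \<not> inside y a c"
    | (3) a c where "inside y a c" "\<And>a c. \<not> inside x a c" | (4) "\<And>a c. \<not> inside y a c" "\<And>a c. \<not> inside x a c"
    by blast
  then show "g x \<le> g y"
  proof cases
    case 1
    have "a \<le> a'"
    proof (rule ccontr)
      assume "\<not> a \<le> a'"
      then show False using layer_unique(1)[OF 1(1), of a' c'] 1 xy by (auto simp: inside_def)
    qed
    then show ?thesis using 1 by (simp add: g_inside)
  next
    case 2
    then show ?thesis using g_inside[OF 2(1)] g_outside[of y] xy by (auto simp: inside_def)
  next
    case 3
    then have "\<not> a < x" using xy 3(1) 3(2)[of a c] by (auto simp: inside_def)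
    then show ?thesis using g_inside[OF 3(1)] g_outside[OF 3(2)] by simp
  next
    case 4
    then show ?thesis using xy by (simp add: g_outside)
  qed
qed

definition layer_ends :: "real set" where
  "layer_ends = (\<Union>(a, c)\<in>{(a, c). {a..c} \<in> J \<and> a < c}. {a, c})"

lemma layer_endsI:
  assumes "{a..c} \<in> J" "a < c" shows "a \<in> layer_ends" "c \<in> layer_ends"
  unfolding layer_ends_def by (rule UN_I[of "(a, c)"]; simp add: assms)+

text \<open>The interiors of the layers of positive length are disjoint nonempty open sets, of which
  the line contains only countably many.\<close>

lemma countable_layer_ends: "countable layer_ends"
proof -
  let ?I = "{(a, c). {a..c} \<in> J \<and> a < c}" and ?F = "\<lambda>(a::real, c). {a<..<c}"
  have inj: "inj_on ?F ?I"
    by (rule inj_onI) (auto simp: greaterThanLessThan_eq_iff)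
  have "countable (?F ` ?I)"
  proof (rule countable_disjoint_open_subsets)
    show "pairwise disjnt (?F ` ?I)"
    proof (rule pairwiseI, rule ccontr)
      fix X Y assume XY: "X \<in> ?F ` ?I" "Y \<in> ?F ` ?I" "X \<noteq> Y" "\<not> disjnt X Y"
      from XY(1) obtain a c where X: "X = {a<..<c}" "{a..c} \<in> J" by auto
      from XY(2) obtain a' c' where Y: "Y = {a'<..<c'}" "{a'..c'} \<in> J" by auto
      from XY(4) obtain x where "x \<in> X" "x \<in> Y" by (auto simp: disjnt_def)
      then show False using layer_unique[of x a c a' c'] X Y XY(3) by (auto simp: inside_def)
    qed
  qed auto
  then have "countable ?I" using inj by (rule countable_image_inj_on)
  then show ?thesis unfolding layer_ends_def by (rule countable_UN) auto
qed

lemma prob_space_P: "prob_space P"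
  using permuton by (simp add: permuton_def)

lemma sets_P: "sets P = sets (restrict_space borel ({0..1} \<times> {0..1}))"
  using permuton by (simp add: permuton_def)

lemma space_P: "space P = {0..1} \<times> {0..1}"
  using sets_eq_imp_space_eq[OF sets_P] by (simp add: space_restrict_space)

lemma fst_measurable: "fst \<in> borel_measurable P"
proof -
  have "(fst :: real \<times> real \<Rightarrow> real) \<in> borel_measurable (restrict_space borel ({0..1} \<times> {0..1}))"
    by (intro measurable_restrict_space1 borel_measurable_continuous_onI continuous_intros)
  then show ?thesis by (simp cong: measurable_cong_sets add: sets_P)
qed

definition U :: "real measure" where
  "U = distr P borel fst"

lemma measure_U: "X \<in> sets borel \<Longrightarrow> measure U X = measure P (fst -` X \<inter> space P)"
  unfolding U_def by (rule measure_distr[OF fst_measurable])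

lemma measure_U_Icc:
  assumes "0 \<le> a" "a \<le> c" "c \<le> 1" shows "measure U {a..c} = c - a"
proof -
  have "fst -` {a..c} \<inter> space P = {a..c} \<times> {0..1}" using assms by (auto simp: space_P)
  then show ?thesis using permuton assms by (simp add: measure_U permuton_def)
qed

sublocale atomless_prob U
proof -
  interpret prob_space U unfolding U_def by (rule prob_space.prob_space_distr[OF prob_space_P fst_measurable])
  show "atomless_prob U"
  proof
    show "sets U = sets borel" by (simp add: U_def)
    show "measure U {x} = 0" for x
    proof (cases "x \<in> {0..1}")
      case True
      then show ?thesis using measure_U_Icc[of x x] by simp
    next
      case False
      then have "fst -` {x} \<inter> space P = {}" by (auto simp: space_P)
      then show ?thesis by (simp add: measure_U)
    qed
  qed
qed

lemma measure_U_Ioo_pos: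
  assumes "0 \<le> a" "a < c" "c \<le> 1" shows "measure U {a<..<c} > 0"
proof -
  \<comment> \<open>The middle third, because marginals are prescribed on closed intervals.\<close>
  have "0 < measure U {a + (c - a) / 3..a + 2 * (c - a) / 3}"
    using assms by (subst measure_U_Icc) (auto simp: field_simps)
  also have "\<dots> \<le> measure U {a<..<c}"
    using assms by (intro finite_measure_mono) (auto simp: sets_U field_simps)
  finally show ?thesis .
qed

text \<open>The typical position of a point: strictly inside a layer of positive length, or away
  from all of these, where the support lies on the diagonal.\<close>

definition on_layer :: "real \<times> real \<Rightarrow> bool" where
  "on_layer z \<longleftrightarrow> (\<exists>a c. inside (fst z) a c \<and> snd z = a + c - fst z) \<or>
    ((\<forall>a c. {a..c} \<in> J \<longrightarrow> a < c \<longrightarrow> fst z < a \<or> c < fst z) \<and> snd z = fst z)"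

text \<open>The support carries the whole mass, and the vertical lines over the layer ends are
  countably many null sets.\<close>

lemma AE_on_layer: "AE z in P. on_layer z"
proof -
  have "AE x in U. \<forall>e\<in>layer_ends. x \<noteq> e"
  proof (subst AE_ball_countable[OF countable_layer_ends], rule ballI)
    fix e
    have "{e} \<in> null_sets U" by (auto simp: emeasure_eq_measure atomless sets_U intro!: null_setsI)
    then have "AE x in U. x \<notin> {e}" by (rule AE_not_in)
    then show "AE x in U. x \<noteq> e" by simp
  qed
  then have ends: "AE z in P. \<forall>e\<in>layer_ends. fst z \<noteq> e"
    unfolding U_def by (rule AE_distrD[OF fst_measurable])
  have "AE z in P. z \<in> msupport P"
  proof (rule AE_msupport)
    fix V :: "(real \<times> real) set" assume "open V"
    then show "V \<inter> space P \<in> sets P"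
      unfolding sets_P space_P sets_restrict_space by (auto simp: Int_commute)
  qed
  with ends show ?thesis
  proof eventually_elim
    case (elim z)
    have "msupport P = {(x, y). \<exists>a b. {a..b} \<in> J \<and> x \<in> {a..b} \<and> y = b - (x - a)}"
      using J unfolding layer_collection_def by (elim conjE)
    then obtain a c where ac: "{a..c} \<in> J" "a \<le> fst z" "fst z \<le> c" "snd z = c - (fst z - a)"
      using elim(2) by (cases z) auto
    show "on_layer z"
    proof (cases "a < c")
      case True
      have "fst z \<noteq> a" "fst z \<noteq> c" using elim(1) layer_endsI[OF ac(1) True] by blast+
      then have "inside (fst z) a c" using ac unfolding inside_def by linarith
      moreover have "snd z = a + c - fst z" using ac(4) by simp
      ultimately show ?thesis unfolding on_layer_def by blast
    next
      case False
      then have eq: "fst z = a" "c = a" "snd z = fst z" using ac by auto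
      have "fst z < a' \<or> c' < fst z" if a': "{a'..c'} \<in> J" "a' < c'" for a' c'
      proof (rule ccontr)
        assume "\<not> ?thesis"
        moreover have "fst z \<noteq> a'" "fst z \<noteq> c'" using elim(1) layer_endsI[OF a'] by blast+
        ultimately have "inside (fst z) a' c'" using a' unfolding inside_def by linarith
        from layer_unique[OF this ac(1-3)] show False using a'(2) eq(2) by simp
      qed
      then show ?thesis using eq(3) unfolding on_layer_def by blast
    qed
  qed
qed

lemma on_layer_cases:
  assumes "on_layer z"
  obtains (inside) a c where "inside (fst z) a c" "snd z = a + c - fst z" "g (fst z) = a"
  | (outside) "\<And>a c. {a..c} \<in> J \<Longrightarrow> a < c \<Longrightarrow> fst z < a \<or> c < fst z" "snd z = fst z" "g (fst z) = fst z"
proof -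
  have "g (fst z) = fst z" if *: "\<forall>a c. {a..c} \<in> J \<longrightarrow> a < c \<longrightarrow> fst z < a \<or> c < fst z"
    by (rule g_outside) (use * in \<open>force simp: inside_def\<close>)
  then show thesis using assms that g_inside unfolding on_layer_def by metis
qed

text \<open>With \<open>on_layer_greater\<close>, ordinates compare first by level and then in
  reverse to abscissas: the order that defines the permutation in
  \<open>occurrence_count\<close>.\<close>

lemma on_layer_less:
  assumes z: "on_layer z" and z': "on_layer z'" and less: "g (fst z) < g (fst z')"
  shows "snd z < snd z'"
  using z
proof (cases rule: on_layer_cases)
  case z: (inside a c)
  show ?thesis using z'
  proof (cases rule: on_layer_cases)
    case z': (inside a' c')
    have "c \<le> a'"
    proof (rule ccontr)
      assume "\<not> c \<le> a'"
      \<comment> \<open>If the layers overlapped, this point would be strictly inside both.\<close>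
      define w where "w = (a' + min c c') / 2"
      have w: "a' < w" "w < c" "w < c'" using \<open>\<not> c \<le> a'\<close> z' by (auto simp: w_def inside_def min_def)
      then have "inside w a c" using z z' less by (auto simp: inside_def)
      then show False using layer_unique(1)[of w a c a' c'] w z z' less by (auto simp: inside_def)
    qed
    then show ?thesis using z z' by (auto simp: inside_def)
  next
    case outside
    then have "fst z' < a \<or> c < fst z'" using z by (auto simp: inside_def)
    then show ?thesis using outside z less by (auto simp: inside_def)
  qed
next
  case outside
  note z = this
  show ?thesis using z'
  proof (cases rule: on_layer_cases)
    case (inside a c)
    then show ?thesis using z less by (auto simp: inside_def)
  qed (use z less in auto)
qed

lemma on_layer_greater:
  assumes z: "on_layer z" and z': "on_layer z'" and eq: "g (fst z) = g (fst z')" and less: "fst z < fst z'"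
  shows "snd z' < snd z"
  using z
proof (cases rule: on_layer_cases)
  case z: (inside a c)
  show ?thesis using z'
  proof (cases rule: on_layer_cases)
    case z': (inside a' c')
    then have "a' = a" using eq z by simp
    then have "c' = c"
      using layer_unique(2)[OF z(1), of a' c'] z z' less by (auto simp: inside_def)
    then show ?thesis using z z' \<open>a' = a\<close> less by simp
  next
    case outside
    then show ?thesis using outside(1)[of a c] z eq less by (auto simp: inside_def)
  qed
next
  case outside
  note z = this
  show ?thesis using z'
  proof (cases rule: on_layer_cases)
    case (inside a c)
    then show ?thesis using z(1)[of a c] z(3) eq by (auto simp: inside_def)
  qed (use z less eq in auto)
qed

end

section \<open>Optimality in terms of levels, and the number of layers\<close>

locale layered_permuton_blocks =
  layered_marginal P J + block_structure "layered_marginal.U P" k m b for P J k m b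
begin

text \<open>Almost surely, the reindexing that witnesses \<open>induces_perm\<close> moves the
  abscissas into \<open>Q g\<close>; a union bound over all reindexings gives the factor
  \<open>fact m\<close>.\<close>

lemma permuton_density_le:
  assumes \<sigma>: "\<And>i j. i \<in> {1..m} \<Longrightarrow> j \<in> {1..m} \<Longrightarrow> \<sigma> i < \<sigma> j \<longleftrightarrow> b i < b j \<or> b i = b j \<and> j < i"
  shows "permuton_density m \<sigma> P \<le> fact m * measure (\<Omega> {1..m}) (Q g)"
proof -
  let ?M = "Pi\<^sub>M {1..m} (\<lambda>_. P)"
  interpret M: prob_space ?M by (intro prob_space_PiM prob_space_P)
  define C where "C \<rho> = {p \<in> space ?M. (\<lambda>n\<in>{1..m}. fst (p (\<rho> n))) \<in> Q g}" for \<rho>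
  have fst': "fst \<in> P \<rightarrow>\<^sub>M U" using fst_measurable by (simp add: U_def)
  have compose: "compose {1..m} fst \<in> ?M \<rightarrow>\<^sub>M \<Omega> {1..m}"
    unfolding compose_def
  proof (rule measurable_restrict)
    fix i assume "i \<in> {1..m}"
    then show "(\<lambda>p. fst (p i)) \<in> ?M \<rightarrow>\<^sub>M U"
      by (rule measurable_compose[OF measurable_component_singleton[where M = "\<lambda>_. P"] fst'])
  qed
  have "distr ?M (\<Omega> {1..m}) (compose {1..m} fst) = Pi\<^sub>M {1..m} (\<lambda>_. distr P U fst)"
    by (rule distr_PiM_finite_prob_space') (simp_all add: prob_space_P prob_space_axioms fst')
  also have "distr P U fst = U" unfolding U_def by (intro distr_cong) simp_all
  finally have distr: "distr ?M (\<Omega> {1..m}) (compose {1..m} fst) = \<Omega> {1..m}" .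
  have C: "C \<rho> \<in> sets ?M" "measure ?M (C \<rho>) = measure (\<Omega> {1..m}) (Q g)" if \<rho>: "\<rho> permutes {1..m}" for \<rho>
  proof -
    let ?B = "{x \<in> space (\<Omega> {1..m}). (\<lambda>n\<in>{1..m}. x (\<rho> n)) \<in> Q g}"
    have \<rho>': "\<rho> \<in> {1..m} \<rightarrow> {1..m}" using permutes_in_image[OF \<rho>] by auto
    have B: "?B \<in> sets (\<Omega> {1..m})" by (rule reindexed_Q_measurable[OF mono_g \<rho>'])
    have eq: "(\<lambda>n\<in>{1..m}. compose {1..m} fst p (\<rho> n)) = (\<lambda>n\<in>{1..m}. fst (p (\<rho> n)))" for p :: "nat \<Rightarrow> real \<times> real"
      using \<rho>' by (intro restrict_ext) (auto simp: compose_def)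
    have vim: "compose {1..m} fst -` ?B \<inter> space ?M = C \<rho>"
    proof (rule set_eqI)
      fix p show "p \<in> compose {1..m} fst -` ?B \<inter> space ?M \<longleftrightarrow> p \<in> C \<rho>"
        using measurable_space[OF compose, of p] unfolding C_def vimage_eq Int_iff mem_Collect_eq eq by blast
    qed
    show "C \<rho> \<in> sets ?M" using measurable_sets[OF compose B] unfolding vim .
    have "measure ?M (C \<rho>) = measure (\<Omega> {1..m}) ?B"
      using measure_distr[OF compose B] unfolding vim distr by (rule sym)
    also have "\<dots> = measure (\<Omega> {1..m}) (Q g)"
      by (rule measure_reindex[OF inj_on_subset[OF permutes_inj[OF \<rho>] subset_UNIV] \<rho>' Q_measurable[OF mono_g]])
    finally show "measure ?M (C \<rho>) = measure (\<Omega> {1..m}) (Q g)" .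
  qed
  have card: "card {\<rho>. \<rho> permutes {1..m}} = fact m" by (rule card_permutations) simp_all
  have fin: "finite {\<rho>. \<rho> permutes {1..m}}" by (rule finite_permutations) simp
  have "AE p in ?M. \<forall>i\<in>{1..m}. on_layer (p i)"
    by (intro AE_finite_allI AE_PiM_component AE_on_layer prob_space_P) simp_all
  then have "AE p in ?M. p \<in> {p \<in> space ?M. induces_perm m \<sigma> p} \<longrightarrow> p \<in> (\<Union>\<rho>\<in>{\<rho>. \<rho> permutes {1..m}}. C \<rho>)"
  proof eventually_elim
    case (elim p)
    show ?case
    proof
      assume p: "p \<in> {p \<in> space ?M. induces_perm m \<sigma> p}"
      then obtain \<rho> where \<rho>: "\<rho> permutes {1..m}"
        and inc: "\<forall>i\<in>{1..m}. \<forall>j\<in>{1..m}. i < j \<longrightarrow> fst (p (\<rho> i)) < fst (p (\<rho> j))"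
        and pat: "\<forall>i\<in>{1..m}. \<forall>j\<in>{1..m}. \<sigma> i < \<sigma> j \<longleftrightarrow> snd (p (\<rho> i)) < snd (p (\<rho> j))"
        unfolding induces_perm_def mem_Collect_eq by (elim conjE exE)
      let ?x = "\<lambda>n\<in>{1..m}. fst (p (\<rho> n))"
      have \<rho>': "\<rho> i \<in> {1..m}" if "i \<in> {1..m}" for i using permutes_in_image[OF \<rho>] that by simp
      have "?x \<in> Q g"
        unfolding Q_def E_def mem_Collect_eq
      proof (intro conjI ballI)
        show "?x \<in> space (\<Omega> {1..m})" by (simp add: space_PiM)
        show "strict_mono_on {1..m} ?x" by (rule strict_mono_onI) (use inc in auto)
        fix i j assume ij: "i \<in> {1..m}" "j \<in> {1..m}"
        note on = elim[rule_format, OF \<rho>'[OF ij(1)]] elim[rule_format, OF \<rho>'[OF ij(2)]]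
        have pat': "\<sigma> i < \<sigma> j \<longleftrightarrow> snd (p (\<rho> i)) < snd (p (\<rho> j))" using pat ij by blast
        have "g (fst (p (\<rho> i))) < g (fst (p (\<rho> j))) \<longleftrightarrow> b i < b j"
        proof
          assume less: "g (fst (p (\<rho> i))) < g (fst (p (\<rho> j)))"
          have "\<not> j < i"
          proof
            assume "j < i"
            then have "fst (p (\<rho> j)) \<le> fst (p (\<rho> i))" using inc ij by (simp add: less_imp_le)
            then show False using monoD[OF mono_g] less by (meson not_le)
          qed
          then show "b i < b j" using on_layer_less[OF on less] pat' \<sigma>[OF ij] by blast
        next
          assume less: "b i < b j"
          then have "i < j" using b_mono[OF ij(2,1)] by (meson not_le)
          then have lt: "fst (p (\<rho> i)) < fst (p (\<rho> j))" using inc ij by blast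
          have "snd (p (\<rho> i)) < snd (p (\<rho> j))" using pat' \<sigma>[OF ij] less by blast
          then have "g (fst (p (\<rho> i))) \<noteq> g (fst (p (\<rho> j)))" using on_layer_greater[OF on _ lt] by fastforce
          then show "g (fst (p (\<rho> i))) < g (fst (p (\<rho> j)))"
            using monoD[OF mono_g less_imp_le[OF lt]] by simp
        qed
        then show "g (?x i) < g (?x j) \<longleftrightarrow> b i < b j" using ij by simp
      qed
      then have "p \<in> C \<rho>" using p unfolding C_def by blast
      then show "p \<in> (\<Union>\<rho>\<in>{\<rho>. \<rho> permutes {1..m}}. C \<rho>)" using \<rho> by blast
    qed
  qed
  then have "measure ?M {p \<in> space ?M. induces_perm m \<sigma> p} \<le> measure ?M (\<Union>\<rho>\<in>{\<rho>. \<rho> permutes {1..m}}. C \<rho>)"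
    using C(1) fin by (intro M.finite_measure_mono_AE sets.finite_UN) auto
  also have "\<dots> \<le> (\<Sum>\<rho>\<in>{\<rho>. \<rho> permutes {1..m}}. measure ?M (C \<rho>))"
    using C(1) fin by (intro M.finite_measure_subadditive_finite) auto
  also have "\<dots> = (\<Sum>\<rho>\<in>{\<rho>. \<rho> permutes {1..m}}. measure (\<Omega> {1..m}) (Q g))"
    by (rule sum.cong[OF refl], rule C(2)) (simp only: mem_Collect_eq)
  also have "\<dots> = fact m * measure (\<Omega> {1..m}) (Q g)"
    using card by (simp only: sum_constant of_nat_fact)
  finally show ?thesis by (simp add: permuton_density_def Let_def)
qed

text \<open>The packing density mediates: \<open>h\<close> bounds it from below, and it equals the
  density of \<open>P\<close>, which \<open>g\<close> bounds from above.\<close>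

lemma optimal_E:
  assumes \<sigma>: "\<And>i j. i \<in> {1..m} \<Longrightarrow> j \<in> {1..m} \<Longrightarrow> \<sigma> i < \<sigma> j \<longleftrightarrow> b i < b j \<or> b i = b j \<and> j < i"
    and opt: "optimal_permuton m \<sigma> P" and h: "mono h"
  shows "measure (\<Omega> {1..m}) (E h) \<le> measure (\<Omega> {1..m}) (E g)"
proof -
  have "fact m * measure (\<Omega> {1..m}) (Q h) \<le> packing_density m \<sigma>"
    by (rule fact_measure_Q_le_packing_density[OF h \<sigma>])
  also have "\<dots> = permuton_density m \<sigma> P" using opt by (simp add: optimal_permuton_def)
  also have "\<dots> \<le> fact m * measure (\<Omega> {1..m}) (Q g)" by (rule permuton_density_le[OF \<sigma>])
  finally have "measure (\<Omega> {1..m}) (Q h) \<le> measure (\<Omega> {1..m}) (Q g)"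
    by (simp add: mult_le_cancel_left_pos)
  then show ?thesis
    unfolding measure_E_eq[OF h] measure_E_eq[OF mono_g] by (intro mult_left_mono) simp_all
qed

text \<open>A competitor with \<open>k\<close> layers of equal length in the unit interval; by
  optimality, \<open>E g\<close> then has positive probability as well.\<close>

lemma measure_E_floor_pos: "measure (\<Omega> {1..m}) (E (\<lambda>x. real_of_int \<lfloor>real k * x\<rfloor>)) > 0"
proof -
  interpret O: prob_space "\<Omega> {1..m}" by (rule prob_space_\<Omega>)
  have h: "mono (\<lambda>x. real_of_int \<lfloor>real k * x\<rfloor>)"
    by (rule monoI) (simp add: floor_mono mult_left_mono)
  define B where "B t = {(real (b t) - 1) / real k <..< real (b t) / real k}" for t
  have bt: "1 \<le> b t" "b t \<le> k" "0 < k" if "t \<in> {1..m}" for t using b_range[OF that] by auto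
  have "0 < (\<Prod>t\<in>{1..m}. measure U (B t))"
  proof (rule prod_pos)
    fix t assume t: "t \<in> {1..m}"
    show "0 < measure U (B t)"
      unfolding B_def by (rule measure_U_Ioo_pos) (use bt[OF t] in \<open>auto simp: field_simps\<close>)
  qed
  also have "\<dots> = measure (\<Omega> {1..m}) {x \<in> space (\<Omega> {1..m}). \<forall>t\<in>{1..m}. x t \<in> B t}"
    by (rule measure_box[symmetric]) (auto simp: B_def)
  also have "\<dots> \<le> measure (\<Omega> {1..m}) (E (\<lambda>x. real_of_int \<lfloor>real k * x\<rfloor>))"
  proof (rule O.finite_measure_mono[OF _ E_measurable[OF h]], rule subsetI)
    fix x assume x: "x \<in> {x \<in> space (\<Omega> {1..m}). \<forall>t\<in>{1..m}. x t \<in> B t}"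
    have fl: "\<lfloor>real k * x t\<rfloor> = int (b t) - 1" if t: "t \<in> {1..m}" for t
    proof -
      have "(real (b t) - 1) / real k < x t" "x t < real (b t) / real k"
        using x t unfolding B_def by auto
      then have "real (b t) - 1 < real k * x t" "real k * x t < real (b t)"
        using bt[OF t] by (auto simp: field_simps)
      then show ?thesis by (intro floor_unique) auto
    qed
    show "x \<in> E (\<lambda>x. real_of_int \<lfloor>real k * x\<rfloor>)"
      unfolding E_def using x by (simp add: fl)
  qed
  finally show ?thesis .
qed

lemma finite_layers:
  assumes \<sigma>: "\<And>i j. i \<in> {1..m} \<Longrightarrow> j \<in> {1..m} \<Longrightarrow> \<sigma> i < \<sigma> j \<longleftrightarrow> b i < b j \<or> b i = b j \<and> j < i"
    and opt: "optimal_permuton m \<sigma> P" and k: "k \<ge> 2" and L: "block_size 1 \<ge> 2" "block_size k \<ge> 2"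
    and adj: "\<And>i. i \<in> {1..<k} \<Longrightarrow> max (block_size 1) (block_size k) + 1 \<le> block_size i + block_size (i + 1)"
  shows "finite J"
proof -
  note opt' = optimal_E[OF \<sigma> opt]
  have form: "\<exists>a c. 0 \<le> a \<and> a \<le> c \<and> c \<le> 1 \<and> I = {a..c}" if "I \<in> J" for I
    using J that unfolding layer_collection_def by (elim conjE) (erule bspec)
  have bounds: "0 \<le> a \<and> c \<le> 1" if "{a..c} \<in> J" "a \<le> c" for a c
    using form[OF that(1)] that(2) by (auto simp: Icc_eq_Icc)
  define V where "V = {v. measure U {x. g x = v} > 0}"
  have "finite V"
    unfolding V_def by (rule finite_positive_levels[OF mono_g opt' _ L adj]) (use k in auto)
  define Pos where "Pos = {I \<in> J. \<exists>a c. I = {a..c} \<and> a < c}"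
  have V: "a \<in> V" if ac: "{a..c} \<in> J" "a < c" for a c
  proof -
    have "0 < measure U {a<..<c}" using ac bounds[of a c] by (intro measure_U_Ioo_pos) auto
    also have "\<dots> \<le> measure U {x. g x = a}"
    proof (rule finite_measure_mono)
      show "{a<..<c} \<subseteq> {x. g x = a}" using g_inside[of _ a c] ac by (auto simp: inside_def)
      show "{x. g x = a} \<in> sets U" unfolding sets_U by (rule level_set_borel[OF _ mono_g]) simp
    qed
    finally show ?thesis by (simp add: V_def)
  qed
  have "finite Pos"
  proof (rule inj_on_finite[of Inf Pos V])
    show "Inf ` Pos \<subseteq> V" using V by (auto simp: Pos_def)
    show "inj_on Inf Pos"
    proof (rule inj_onI)
      fix I I' assume I: "I \<in> Pos" "I' \<in> Pos" "Inf I = Inf I'"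
      then obtain a c a' c' where *: "I = {a..c}" "a < c" "I' = {a'..c'}" "a' < c'" "I \<in> J" "I' \<in> J"
        unfolding Pos_def by blast
      then have "a' = a" using I(3) by simp
      then have "inside (a + min (c - a) (c' - a) / 2) a c"
        using * by (auto simp: inside_def min_def field_simps)
      then have "c' = c"
        by (rule layer_unique) (use * \<open>a' = a\<close> in \<open>auto simp: min_def field_simps\<close>)
      then show "I = I'" using * \<open>a' = a\<close> by simp
    qed
  qed fact
  show "finite J"
  proof (rule ccontr)
    assume "infinite J"
    define D where "D = {x. {x} \<in> J}"
    define K where "K = \<Union>Pos"
    define Ends where "Ends = Inf ` Pos \<union> Sup ` Pos"
    have "J \<subseteq> Pos \<union> (\<lambda>x. {x}) ` D"
    proof
      fix I assume I: "I \<in> J"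
      then obtain a c where "a \<le> c" "I = {a..c}" using form by blast
      then show "I \<in> Pos \<union> (\<lambda>x. {x}) ` D"
        using I by (cases "a < c") (auto simp: Pos_def D_def)
    qed
    then have "infinite D"
      using \<open>infinite J\<close> \<open>finite Pos\<close> by (meson finite_Un finite_imageI finite_subset)
    moreover have "finite Ends" using \<open>finite Pos\<close> by (simp add: Ends_def)
    \<comment> \<open>A layer of length zero may sit at an end of a longer layer. These ends are
      finitely many, so one away from all of them can be chosen.\<close>
    ultimately obtain x where x: "x \<in> D" "x \<notin> Ends" by (meson finite_subset subsetI)
    have x01: "0 \<le> x" "x \<le> 1" using bounds[of x x] x(1) by (auto simp: D_def)
    have "x \<notin> K"
    proof
      assume "x \<in> K"
      then obtain a c where ac: "{a..c} \<in> Pos" "a < c" "a \<le> x" "x \<le> c" unfolding K_def Pos_def by auto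
      have "Inf {a..c} \<in> Ends" "Sup {a..c} \<in> Ends" using ac(1) by (auto simp only: Ends_def)
      then have "a \<in> Ends" "c \<in> Ends" using ac(2) by simp_all
      then have "x \<noteq> a" "x \<noteq> c" using x(2) by auto
      then have "inside x a c" using ac unfolding inside_def Pos_def by auto
      from layer_unique[OF this, of x x] show False using x(1) ac(2) by (auto simp: D_def)
    qed
    moreover have "closed K"
      unfolding K_def using \<open>finite Pos\<close> by (rule closed_Union) (auto simp: Pos_def)
    ultimately obtain r where r: "r > 0" "ball x r \<subseteq> - K"
      using open_contains_ball[of "- K"] by (auto simp: closed_def)
    \<comment> \<open>Clipped to the unit interval, outside of which \<open>U\<close> has no
      mass.\<close>
    define c where "c = max 0 (x - r)"
    define d where "d = min 1 (x + r)"
    have cd: "0 \<le> c" "c < d" "d \<le> 1" using x01 r(1) by (auto simp: c_def d_def)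
    have notK: "y \<notin> K" if "c < y" "y < d" for y
    proof -
      have "y \<in> ball x r" using that by (auto simp: c_def d_def dist_real_def)
      then show ?thesis using r(2) by blast
    qed
    \<comment> \<open>The second alternative says that no point from outside is sent into the
      stretch, so the level sets there are singletons.\<close>
    have g_id: "g y = y" if "c < y \<and> y < d \<or> c < g y \<and> g y < d" for y
    proof (rule g_outside, rule notI)
      fix a e assume in_layer: "inside y a e"
      then have "{a..e} \<in> Pos" by (auto simp: inside_def Pos_def)
      moreover have "y \<in> {a..e}" "g y \<in> {a..e}"
        using in_layer g_inside[OF in_layer] by (auto simp: inside_def)
      ultimately have "y \<in> K" "g y \<in> K" unfolding K_def by blast+
      then show False using that notK by blast
    qed
    let ?e = "(c + d) / 2"
    show False
    proof (rule no_null_stretch[OF mono_g opt' k, where c = c and e = ?e and d = d])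
      show "block_size i \<ge> 2 \<or> block_size (i + 1) \<ge> 2" if "i \<in> {1..<k}" for i using adj[OF that] L by auto
      show "measure (\<Omega> {1..m}) (E g) > 0"
      proof (rule less_le_trans[OF measure_E_floor_pos opt'])
        show "mono (\<lambda>x. real_of_int \<lfloor>real k * x\<rfloor>)"
          by (rule monoI) (simp add: floor_mono mult_left_mono)
      qed
      show "c < ?e" "?e < d" using cd by auto
      show "measure U {y. g y = v} = 0" if "v \<in> {c<..<d}" for v
      proof -
        have "{y. g y = v} = {v}" using g_id that by force
        then show ?thesis by (simp add: atomless)
      qed
      have "{y. c < g y \<and> g y \<le> ?e} \<in> sets borel" "{y. ?e < g y \<and> g y < d} \<in> sets borel"
        by (rule level_set_borel[OF _ mono_g]; measurable)+
      then have sets: "{y. c < g y \<and> g y \<le> ?e} \<in> sets U" "{y. ?e < g y \<and> g y < d} \<in> sets U"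
        by (simp_all only: sets_U)
      have e: "0 \<le> c" "c < ?e" "?e < d" "0 \<le> ?e" "?e \<le> 1" using cd by auto
      have g_id': "g y = y" if "c < y" "y < d" for y using g_id that by blast
      have "{c<..<?e} \<subseteq> {y. c < g y \<and> g y \<le> ?e}"
        using g_id' cd by (intro subsetI) (simp add: field_simps)
      from finite_measure_mono[OF this sets(1)] show "measure U {y. c < g y \<and> g y \<le> ?e} > 0"
        using measure_U_Ioo_pos[OF e(1,2,5)] by linarith
      have "{?e<..<d} \<subseteq> {y. ?e < g y \<and> g y < d}"
        using g_id' cd by (intro subsetI) (simp add: field_simps)
      from finite_measure_mono[OF this sets(2)] show "measure U {y. ?e < g y \<and> g y < d} > 0"
        using measure_U_Ioo_pos[OF e(4,3) cd(3)] by linarith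
    qed
  qed
qed

end

theorem theorem1p5:
  fixes k :: nat and l \<sigma> :: "nat \<Rightarrow> nat" and P :: "(real \<times> real) measure"
  assumes "k \<ge> 2"
    and "layered_perm k l \<sigma>"
    and "l 1 \<ge> 2" and "l k \<ge> 2"
    and "\<forall>i\<in>{1..k - 1}. l i + l (i + 1) \<ge> max (l 1) (l k) + 1"
    and "layered_permuton P"
    and "optimal_permuton (\<Sum>i=1..k. l i) \<sigma> P"
  shows "finite (layers P)"
proof -
  obtain J where PJ: "permuton P" "layer_collection P J"
    using assms(6) by (auto simp: layered_permuton_def)
  interpret layered_marginal P J by unfold_locales (fact PJ)+
  define m where "m = (\<Sum>i=1..k. l i)"
  obtain b where b: "\<And>i. i \<in> {1..m} \<Longrightarrow> b i \<in> {1..k}"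
    "\<And>i j. i \<in> {1..m} \<Longrightarrow> j \<in> {1..m} \<Longrightarrow> i \<le> j \<Longrightarrow> b i \<le> b j"
    "\<And>j. j \<in> {1..k} \<Longrightarrow> card {t \<in> {1..m}. b t = j} = l j"
    "\<And>i j. i \<in> {1..m} \<Longrightarrow> j \<in> {1..m} \<Longrightarrow> \<sigma> i < \<sigma> j \<longleftrightarrow> b i < b j \<or> b i = b j \<and> j < i"
    unfolding m_def using layered_perm_blocks[OF assms(2)] by blast
  interpret layered_permuton_blocks P J k m b
  proof unfold_locales
    fix j assume j: "j \<in> {1..k}"
    then have "card {t \<in> {1..m}. b t = j} \<noteq> 0"
      using b(3)[OF j] assms(2) unfolding layered_perm_def by (metis not_one_le_zero)
    then have "{t \<in> {1..m}. b t = j} \<noteq> {}" by (metis card.empty)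
    then show "\<exists>i\<in>{1..m}. b i = j" by blast
  qed (use b in auto)
  have L: "block_size j = l j" if "j \<in> {1..k}" for j using b(3)[OF that] by (simp add: block_size_def)
  have "finite J"
  proof (rule finite_layers[OF b(4)])
    show "optimal_permuton m \<sigma> P" using assms(7) by (simp add: m_def)
    show "max (block_size 1) (block_size k) + 1 \<le> block_size i + block_size (i + 1)" if "i \<in> {1..<k}" for i
    proof -
      have "i \<in> {1..k - 1}" "i \<in> {1..k}" "i + 1 \<in> {1..k}" "1 \<in> {1..k}" "k \<in> {1..k}" using that by auto
      then show ?thesis using assms(5) L by metis
    qed
  qed (use assms(1,3,4) L in auto)
  then show ?thesis using layers_eq[OF PJ(2)] by simp
qed

end
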